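(* Let $\mathbb{B}^2=\{z\in\mathbb{C}^2:|z|<1\}$ and, for $r\in(0,1)$, let $\Omega_r=\{z\in\mathbb{C}^2:r<|z|<1\}$. For all sufficiently small $r>0$ and all sufficiently small $\epsilon>0$, with $p=(r+\epsilon,0)$, one has $$F_B^{\Omega_r}(p,\xi)<F_B^{\mathbb{B}^2}(p,\xi)\qquad\text{for every }\xi\in\mathbb{C}^2\setminus\{0\}.$$ That is, there exists $r_0\in(0,1)$ such that for every $r\in(0,r_0)$ there exists $\epsilon_0>0$ (with $r+\epsilon_0<1$) such that the inequality holds for every $\epsilon\in(0,\epsilon_0)$ and every $\xi\in\mathbb{C}^2\setminus\{0\}$.
   Context: $|z|$ denotes the Euclidean norm on $\mathbb{C}^2$. For a bounded domain $D\subset\mathbb{C}^n$, $K_D$ denotes the Bergman kernel of $D$ (the reproducing kernel of the space $L^2_h(D)$ of square-integrable holomorphic functions on $D$). The Bergman metric of $D$ at $p\in D$ in direction $\xi\in\mathbb{C}^n$ is $$F_B^{D}(p,\xi)=\left(\sum_{\nu,\mu=1}^{n}\frac{\partial^2\log K_D(z,z)}{\partial z_\nu\,\partial\overline{z_\mu}}\Big|_{z=p}\,\xi_\nu\overline{\xi_\mu}\right)^{1/2}.$$ *)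

theory Defs
  imports "HOL-Analysis.Analysis"
begin

definition holomorphic_vec_on :: "(complex ^ 'n \<Rightarrow> complex) \<Rightarrow> (complex ^ 'n) set \<Rightarrow> bool"
  where "holomorphic_vec_on f D \<longleftrightarrow>
    (\<forall>z\<in>D. \<exists>L. (f has_derivative L) (at z within D) \<and> (\<forall>c v. L (c *s v) = c * L v))"

text \<open>
  The space \<open>L\<^sup>2\<^sub>h(D)\<close>. Its elements are functions on the whole type, of which only the values
  on \<open>D\<close> are constrained.
\<close>

definition L2h :: "(complex ^ 'n) set \<Rightarrow> (complex ^ 'n \<Rightarrow> complex) set"
  where "L2h D = {f. holomorphic_vec_on f D \<and> set_integrable lborel D (\<lambda>z. (norm (f z))\<^sup>2)}"

text \<open>
  The first conjunct pins \<open>K\<close> down outside \<open>D \<times> D\<close>, so that a reproducing kernel is unique as a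
  total function.
\<close>

definition is_bergman_kernel ::
    "(complex ^ 'n) set \<Rightarrow> (complex ^ 'n \<Rightarrow> complex ^ 'n \<Rightarrow> complex) \<Rightarrow> bool"
  where "is_bergman_kernel D K \<longleftrightarrow>
    (\<forall>z w. z \<notin> D \<or> w \<notin> D \<longrightarrow> K z w = 0) \<and>
    (\<forall>w\<in>D. (\<lambda>z. K z w) \<in> L2h D \<and>
      (\<forall>f\<in>L2h D. f w = (LINT z:D|lborel. f z * cnj (K z w))))"

lemma is_bergman_kernel_unique:
  fixes D :: "(complex ^ 'n) set"
  assumes K: "is_bergman_kernel D K" and K': "is_bergman_kernel D K'"
  shows "K = K'"
proof -
  have sym: "A z w = cnj (B w z)"
    if A: "is_bergman_kernel D A" and B: "is_bergman_kernel D B" and zw: "z \<in> D" "w \<in> D"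
    for A B :: "complex ^ 'n \<Rightarrow> complex ^ 'n \<Rightarrow> complex" and z w
  proof -
    have "(\<lambda>x. A x w) \<in> L2h D" "(\<lambda>x. B x z) \<in> L2h D"
      using A B zw unfolding is_bergman_kernel_def by simp_all
    then have 1: "A z w = (LINT x:D|lborel. A x w * cnj (B x z))"
      and 2: "B w z = (LINT x:D|lborel. B x z * cnj (A x w))"
      using A B zw unfolding is_bergman_kernel_def by auto
    have "cnj (B w z) = (LINT x:D|lborel. cnj (B x z * cnj (A x w)))"
      unfolding 2 set_lebesgue_integral_def
      by (subst Bochner_Integration.integral_cnj[symmetric]) (simp add: scaleR_conv_of_real)
    with 1 show ?thesis
      by (simp add: mult.commute)
  qed
  have "K z w = K' z w" if "z \<in> D" "w \<in> D" for z w
    using sym[OF K K that] sym[OF K' K that(2,1)] that sym[OF K K'] sym[OF K' K'] by metis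
  moreover have "K z w = K' z w" if "z \<notin> D \<or> w \<notin> D" for z w
    using K K' that unfolding is_bergman_kernel_def by metis
  ultimately show ?thesis
    by blast
qed

definition bergman_kernel ::
    "(complex ^ 'n) set \<Rightarrow> complex ^ 'n \<Rightarrow> complex ^ 'n \<Rightarrow> complex"
  where "bergman_kernel D = (THE K. is_bergman_kernel D K)"

text \<open>
  The Wirtinger derivatives \<open>\<partial>/\<partial>z\<^sub>j = (\<partial>/\<partial>x\<^sub>j - \<i> \<partial>/\<partial>y\<^sub>j) / 2\<close> and
  \<open>\<partial>/\<partial>cnj z\<^sub>j = (\<partial>/\<partial>x\<^sub>j + \<i> \<partial>/\<partial>y\<^sub>j) / 2\<close>, where \<open>z\<^sub>j = x\<^sub>j + \<i> y\<^sub>j\<close>.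
\<close>

definition wirtinger :: "'n \<Rightarrow> (complex ^ 'n \<Rightarrow> complex) \<Rightarrow> complex ^ 'n \<Rightarrow> complex"
  where "wirtinger j g z =
    (vector_derivative (\<lambda>t. g (z + axis j (of_real t))) (at 0)
      - \<i> * vector_derivative (\<lambda>t. g (z + axis j (\<i> * of_real t))) (at 0)) / 2"

definition wirtinger_cnj :: "'n \<Rightarrow> (complex ^ 'n \<Rightarrow> complex) \<Rightarrow> complex ^ 'n \<Rightarrow> complex"
  where "wirtinger_cnj j g z =
    (vector_derivative (\<lambda>t. g (z + axis j (of_real t))) (at 0)
      + \<i> * vector_derivative (\<lambda>t. g (z + axis j (\<i> * of_real t))) (at 0)) / 2"

text \<open>
  Both \<open>bergman_kernel D z z\<close> and the Hermitian form under the square root are real, so \<open>Re\<close> only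
  changes the type.
\<close>

definition bergman_metric :: "(complex ^ 'n) set \<Rightarrow> complex ^ 'n \<Rightarrow> complex ^ 'n \<Rightarrow> real"
  where "bergman_metric D p \<xi> =
    sqrt (Re (\<Sum>\<nu>\<in>UNIV. \<Sum>\<mu>\<in>UNIV.
      wirtinger \<nu> (wirtinger_cnj \<mu> (\<lambda>z. complex_of_real (ln (Re (bergman_kernel D z z))))) p
        * \<xi> $ \<nu> * cnj (\<xi> $ \<mu>)))"

definition shell :: "real \<Rightarrow> (complex ^ 2) set"
  where "shell r = {z. r < norm z \<and> norm z < 1}"

end

theory Submission
  imports Defs "HOL-Complex_Analysis.Complex_Analysis"
begin

unbundle no fps_syntax

text \<open>
  Every holomorphic function \<open>f\<close> on the shell \<open>r < |z| < 1\<close> has monomial moments like a function on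
  the ball: the average of \<open>f (x, \<sqdot>)\<close> over the circles \<open>|y| = const\<close> contained in the shell does not
  depend on the radius, which yields a holomorphic extension \<open>G\<close> of \<open>f (\<sqdot>, 0)\<close> to the whole unit disc
  (Hartogs), and averaging \<open>f (x, y) cnj x ^ k\<close> over both rotations leaves the \<open>k\<close>-th Taylor
  coefficient of \<open>G\<close> times \<open>|x| ^ (2 k)\<close>. Together with unitary invariance this gives the kernels
  \<open>(1 / pi\<^sup>2) \<Sum>k. (k + 1) (k + 2) / (1 - r ^ (2 k + 4)) \<langle>z, w\<rangle> ^ k\<close> of the shell and, with \<open>r = 0\<close> in this
  formula, of the ball.

  If \<open>log K (z, z) = g (|z|\<^sup>2)\<close> then the squared Bergman metric is
  \<open>g' (|z|\<^sup>2) |\<xi>|\<^sup>2 + g'' (|z|\<^sup>2) |\<langle>\<xi>, z\<rangle>|\<^sup>2\<close>, so with \<open>t = |z|\<^sup>2\<close> it has to be shown that \<open>g'\<close> and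
  \<open>g' + t g''\<close> are smaller for the shell. The two functions \<open>g\<close> differ by \<open>ln (1 + u)\<close> with
  \<open>u t = (1 - t)\<^sup>3 h t / 2\<close> and \<open>h t = \<Sum>k. (k + 1) (k + 2) q ^ (k + 2) / (1 - q ^ (k + 2)) t ^ k\<close>, where
  \<open>q = r\<^sup>2\<close>. For small \<open>q\<close> and \<open>t\<close> the constant term of \<open>h\<close> dominates, whence \<open>u' < 0\<close> and
  \<open>u' + t u'' < 0\<close>.
\<close>

section \<open>Maps preserving Lebesgue measure\<close>

definition lborel_preserving :: "('a::euclidean_space \<Rightarrow> 'a) \<Rightarrow> bool"
  where "lborel_preserving T \<longleftrightarrow> T \<in> borel_measurable borel \<and> distr lborel lborel T = lborel"

lemma lborel_preserving_comp:
  assumes "lborel_preserving S" "lborel_preserving T"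
  shows "lborel_preserving (S \<circ> T)"
proof -
  have "distr lborel lborel (S \<circ> T) = distr (distr lborel lborel T) lborel S"
    using assms by (subst distr_distr) (auto simp: lborel_preserving_def)
  with assms show ?thesis
    unfolding lborel_preserving_def by (metis measurable_comp)
qed

lemma lborel_preserving_integral:
  fixes f :: "'a::euclidean_space \<Rightarrow> 'b::{banach,second_countable_topology}"
  assumes "lborel_preserving T" "f \<in> borel_measurable borel"
  shows "(\<integral>x. f (T x) \<partial>lborel) = (\<integral>x. f x \<partial>lborel)"
proof -
  have "(\<integral>x. f x \<partial>distr lborel lborel T) = (\<integral>x. f (T x) \<partial>lborel)"
    using assms by (intro integral_distr) (auto simp: lborel_preserving_def)
  with assms show ?thesis by (simp add: lborel_preserving_def)
qed

lemma lborel_preservingI: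
  assumes [measurable]: "T \<in> borel_measurable borel"
    and "\<And>X. X \<in> sets borel \<Longrightarrow> emeasure lborel (T -` X) = emeasure lborel X"
  shows "lborel_preserving T"
  unfolding lborel_preserving_def
proof safe
  show "distr lborel lborel T = lborel"
    using assms(2) by (intro measure_eqI) (auto simp: emeasure_distr)
qed fact

lemma emeasure_lborel_translate:
  fixes c :: "'a::euclidean_space"
  assumes "A \<in> sets borel"
  shows "emeasure lborel ((\<lambda>x. x + c) -` A) = emeasure lborel A"
proof -
  have "emeasure (distr lborel borel ((+) c)) A = emeasure lborel ((+) c -` A)"
    using assms by (subst emeasure_distr) auto
  then show ?thesis
    by (simp add: lborel_distr_plus add.commute[of _ c])
qed

lemma emeasure_lborel_prod_alt:
  fixes X :: "('a::euclidean_space \<times> 'b::euclidean_space) set"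
  assumes "X \<in> sets borel"
  shows "emeasure lborel X = (\<integral>\<^sup>+y. emeasure lborel ((\<lambda>x. (x, y)) -` X) \<partial>lborel)"
proof -
  have "X \<in> sets (lborel \<Otimes>\<^sub>M lborel)"
    using assms by (simp only: lborel_prod sets_lborel)
  from lborel_pair.emeasure_pair_measure_alt2[OF this] show ?thesis
    by (simp only: lborel_prod)
qed

text \<open>For fixed \<open>y\<close> the section of the preimage is a translate of the section of
  \<open>X\<close>, so both have the same measure; integrating over \<open>y\<close> gives the claim
  (Cavalieri).\<close>

lemma lborel_preserving_shear1:
  fixes a :: "'a::{euclidean_space,real_normed_field}"
  shows "lborel_preserving (\<lambda>(x,y). (x + a * y, y))"
proof (rule lborel_preservingI)
  show meas: "(\<lambda>(x,y). (x + a * y, y)) \<in> borel_measurable (borel :: ('a \<times> 'a) measure)"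
    unfolding case_prod_beta by (intro borel_measurable_continuous_onI continuous_intros)
  fix X :: "('a \<times> 'a) set" assume X: "X \<in> sets borel"
  let ?T = "(\<lambda>(x,y). (x + a * y, y)) :: 'a \<times> 'a \<Rightarrow> 'a \<times> 'a"
  have TX: "?T -` X \<in> sets borel"
    using measurable_sets[OF meas X] by simp
  have sec: "(\<lambda>x. (x, y)) -` X \<in> sets borel" for y
  proof -
    have "(\<lambda>x. (x, y)) \<in> borel_measurable (borel :: 'a measure)"
      by (intro borel_measurable_continuous_onI continuous_intros)
    from measurable_sets[OF this X] show ?thesis by simp
  qed
  have "emeasure lborel (?T -` X)
     = (\<integral>\<^sup>+y. emeasure lborel ((\<lambda>x. (x, y)) -` (?T -` X)) \<partial>lborel)"
    using TX by (rule emeasure_lborel_prod_alt)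
  also have "\<dots> = (\<integral>\<^sup>+y. emeasure lborel ((\<lambda>x. (x, y)) -` X) \<partial>lborel)"
  proof (rule nn_integral_cong)
    fix y
    have "(\<lambda>x. (x, y)) -` (?T -` X) = (\<lambda>x. x + a * y) -` ((\<lambda>x. (x, y)) -` X)" by auto
    then show "emeasure lborel ((\<lambda>x. (x, y)) -` (?T -` X)) = emeasure lborel ((\<lambda>x. (x, y)) -` X)"
      using emeasure_lborel_translate[OF sec] by simp
  qed
  also have "\<dots> = emeasure lborel X"
    using X by (rule emeasure_lborel_prod_alt[symmetric])
  finally show "emeasure lborel (?T -` X) = emeasure lborel X" .
qed

lemma lborel_preserving_swap:
  "lborel_preserving (\<lambda>(x, y). (y, x :: 'a::euclidean_space))"
proof -
  have "distr lborel lborel (\<lambda>(x :: 'a, y :: 'a). (y, x)) = lborel"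
    using lborel_pair.distr_pair_swap[where ?'a='a and ?'b='a] by (simp add: lborel_prod eq_commute[of lborel])
  moreover have "(\<lambda>(x :: 'a, y :: 'a). (y, x)) \<in> borel_measurable borel"
    unfolding case_prod_beta by (intro borel_measurable_continuous_onI continuous_intros)
  ultimately show ?thesis by (simp add: lborel_preserving_def)
qed

lemma lborel_preserving_shear2:
  fixes a :: "'a::{euclidean_space,real_normed_field}"
  shows "lborel_preserving (\<lambda>(x,y). (x, y + a * x))"
proof -
  have "lborel_preserving ((\<lambda>(x, y). (y, x)) \<circ> (\<lambda>(x,y). (x + a * y, y)) \<circ> (\<lambda>(x, y). (y, x :: 'a)))"
    by (intro lborel_preserving_comp lborel_preserving_swap lborel_preserving_shear1)
  also have "((\<lambda>(x, y). (y, x)) \<circ> (\<lambda>(x,y). (x + a * y, y)) \<circ> (\<lambda>(x, y). (y, x :: 'a)))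
      = (\<lambda>(x,y). (x, y + a * x))" by auto
  finally show ?thesis .
qed

text \<open>A matrix of determinant 1 with nonzero lower left entry is a product of three shears.
  Over the reals this covers plane rotations, over the complex numbers the matrices of SU(2); both
  are used below.\<close>

lemma lborel_preserving_SL2:
  fixes a b c d :: "'a::{euclidean_space,real_normed_field}"
  assumes det: "a * d - b * c = 1"
  shows "lborel_preserving (\<lambda>(x,y). (a * x + b * y, c * x + d * y))"
proof -
  have main: "lborel_preserving (\<lambda>(x,y). (a * x + b * y, c * x + d * y))"
    if det: "a * d - b * c = 1" and c: "c \<noteq> 0" for a b c d :: 'a
  proof -
    have b: "b = (a * d - 1) / c" using det c by (simp add: field_simps)
    have "lborel_preserving ((\<lambda>(x,y). (x + (a - 1) / c * y, y)) \<circ> (\<lambda>(x,y). (x, y + c * x))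
            \<circ> (\<lambda>(x,y). (x + (d - 1) / c * y, y)))"
      by (intro lborel_preserving_comp lborel_preserving_shear1 lborel_preserving_shear2)
    also have "((\<lambda>(x,y). (x + (a - 1) / c * y, y)) \<circ> (\<lambda>(x,y). (x, y + c * x))
            \<circ> (\<lambda>(x,y). (x + (d - 1) / c * y, y))) = (\<lambda>(x,y). (a * x + b * y, c * x + d * y))"
      using c by (auto simp: fun_eq_iff b field_simps)
    finally show ?thesis .
  qed
  show ?thesis
  proof (cases "c = 0")
    case False
    then show ?thesis using main det by blast
  next
    case True
    then have a: "a \<noteq> 0" using det by auto
    \<comment> \<open>If \<open>c = 0\<close>, adding the first row to the second puts the nonzero
      entry \<open>a\<close> into the lower left corner; a further shear undoes the row
      operation.\<close>
    have "a * (d + b) - b * (c + a) = 1" using det by (simp add: algebra_simps)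
    then have "lborel_preserving ((\<lambda>(x,y). (x, y + (- 1) * x)) \<circ>
        (\<lambda>(x,y). (a * x + b * y, (c + a) * x + (d + b) * y)))"
      by (intro lborel_preserving_comp lborel_preserving_shear2 main) (use True a in auto)
    also have "((\<lambda>(x,y). (x, y + (- 1) * x)) \<circ>
        (\<lambda>(x,y). (a * x + b * y, (c + a) * x + (d + b) * y)))
        = (\<lambda>(x,y). (a * x + b * y, c * x + d * y))"
      by (auto simp: fun_eq_iff algebra_simps)
    finally show ?thesis .
  qed
qed

section \<open>Rotations of the complex plane, product maps and the passage to vectors\<close>

text \<open>A complex box pulls back to a box with the same side lengths in the real plane, and
  Lebesgue measure is determined by its values on boxes.\<close>

lemma lborel_distr_Complex: "distr lborel lborel (\<lambda>(x, y). Complex x y) = lborel"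
proof -
  have meas[measurable]: "(\<lambda>(x, y). Complex x y) \<in> borel_measurable borel"
    unfolding case_prod_beta Complex_eq
    by (intro borel_measurable_continuous_onI continuous_intros)
  show ?thesis
  proof (rule lborel_eqI[symmetric])
    fix l u :: complex assume le: "\<And>b. b \<in> Basis \<Longrightarrow> l \<bullet> b \<le> u \<bullet> b"
    have "emeasure (distr lborel lborel (\<lambda>(x, y). Complex x y)) (box l u)
       = emeasure lborel ((\<lambda>(x, y). Complex x y) -` box l u)"
      by (subst emeasure_distr) auto
    also have "(\<lambda>(x, y). Complex x y) -` box l u = box (Re l, Im l) (Re u, Im u)"
      by (auto simp: box_def Basis_complex_def Basis_prod_def)
    also have "emeasure lborel \<dots> = (\<Prod>b\<in>Basis. ((Re u, Im u) - (Re l, Im l)) \<bullet> b)"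
      using le[of 1] le[of \<i>] by (intro emeasure_lborel_box) (auto simp: Basis_complex_def Basis_prod_def)
    also have "(\<Prod>b\<in>Basis. ((Re u, Im u) - (Re l, Im l)) \<bullet> b) = (\<Prod>b\<in>Basis. (u - l) \<bullet> b)"
    proof -
      have B: "Basis = {(1::real,0::real),(0,1)}" by (auto simp: Basis_prod_def)
      show ?thesis unfolding B Basis_complex_def by simp
    qed
    finally show "emeasure (distr lborel lborel (\<lambda>(x, y). Complex x y)) (box l u)
        = ennreal (\<Prod>b\<in>Basis. (u - l) \<bullet> b)" .
  qed auto
qed

text \<open>In real coordinates, multiplication by \<open>c\<close> is a matrix of determinant |c|^2
  = 1; the real case of \<open>lborel_preserving_SL2\<close> is carried over along
  \<open>Complex\<close>.\<close>

lemma lborel_preserving_rotation: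
  fixes c :: complex
  assumes "norm c = 1"
  shows "lborel_preserving (\<lambda>x. c * x)"
proof -
  let ?C = "\<lambda>(x, y). Complex x y"
  let ?R = "\<lambda>(x, y). (Re c * x + - Im c * y, Im c * x + Re c * y)"
  have C[measurable]: "?C \<in> borel_measurable borel"
    unfolding case_prod_beta Complex_eq
    by (intro borel_measurable_continuous_onI continuous_intros)
  have "Re c * Re c - - Im c * Im c = 1"
    using assms cmod_power2[of c] by (simp add: power2_eq_square)
  then have R: "lborel_preserving ?R" by (rule lborel_preserving_SL2)
  have [measurable]: "(\<lambda>x. c * x) \<in> borel_measurable borel"
    by (intro borel_measurable_continuous_onI continuous_intros)
  have "distr lborel lborel (\<lambda>x. c * x) = distr (distr lborel lborel ?C) lborel (\<lambda>x. c * x)"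
    by (simp only: lborel_distr_Complex)
  also have "\<dots> = distr lborel lborel ((\<lambda>x. c * x) \<circ> ?C)"
    by (intro distr_distr) auto
  also have "(\<lambda>x. c * x) \<circ> ?C = ?C \<circ> ?R"
    by (auto simp: fun_eq_iff complex_eq_iff)
  also have "distr lborel lborel (?C \<circ> ?R) = distr (distr lborel lborel ?R) lborel ?C"
    using R by (intro distr_distr[symmetric]) (auto simp: lborel_preserving_def)
  also have "\<dots> = lborel"
    using R by (simp only: lborel_preserving_def lborel_distr_Complex)
  finally show ?thesis by (simp add: lborel_preserving_def)
qed

lemma lborel_preserving_snd:
  assumes "lborel_preserving (T :: 'a::euclidean_space \<Rightarrow> 'a)"
  shows "lborel_preserving (\<lambda>(x :: 'b::euclidean_space, y). (x, T y))"
proof -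
  have [measurable]: "T \<in> borel_measurable borel" using assms by (simp add: lborel_preserving_def)
  have "distr lborel lborel (\<lambda>(x :: 'b, y). (x, T y))
     = distr (lborel \<Otimes>\<^sub>M lborel) (lborel \<Otimes>\<^sub>M lborel) (\<lambda>(x :: 'b, y). (x, T y))"
    by (simp add: lborel_prod)
  also have "\<dots> = distr lborel lborel (\<lambda>x. x) \<Otimes>\<^sub>M distr lborel lborel T"
    using assms by (intro pair_measure_distr[symmetric])
      (auto simp: lborel_preserving_def sigma_finite_lborel)
  also have "\<dots> = lborel"
    using assms by (simp add: lborel_preserving_def distr_id2 lborel_prod)
  finally show ?thesis
    unfolding lborel_preserving_def borel_prod[symmetric] by simp
qed

lemma lborel_preserving_fst:
  assumes "lborel_preserving (T :: 'a::euclidean_space \<Rightarrow> 'a)"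
  shows "lborel_preserving (\<lambda>(x, y :: 'b::euclidean_space). (T x, y))"
proof -
  have [measurable]: "T \<in> borel_measurable borel" using assms by (simp add: lborel_preserving_def)
  have "distr lborel lborel (\<lambda>(x, y :: 'b). (T x, y))
     = distr (lborel \<Otimes>\<^sub>M lborel) (lborel \<Otimes>\<^sub>M lborel) (\<lambda>(x, y :: 'b). (T x, y))"
    by (simp add: lborel_prod)
  also have "\<dots> = distr lborel lborel T \<Otimes>\<^sub>M distr lborel lborel (\<lambda>x. x)"
    using assms by (intro pair_measure_distr[symmetric])
      (auto simp: lborel_preserving_def sigma_finite_lborel distr_id2)
  also have "\<dots> = lborel"
    using assms by (simp add: lborel_preserving_def distr_id2 lborel_prod)
  finally show ?thesis
    unfolding lborel_preserving_def borel_prod[symmetric] by simp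
qed

text \<open>Again decided on boxes, whose preimages are products of two boxes. Integrals over
  vectors thereby become integrals over pairs, where Fubini applies.\<close>

lemma lborel_distr_vector_2:
  "distr lborel lborel (\<lambda>(x, y). vector [x, y] :: 'a::euclidean_space ^ 2) = lborel"
proof -
  let ?V = "\<lambda>(x, y). vector [x, y] :: 'a ^ 2"
  have "continuous_on UNIV (\<lambda>z. (\<chi> i. if i = 1 then fst z else snd z) :: 'a ^ 2)"
  proof (rule continuous_on_vec_lambda)
    show "continuous_on UNIV (\<lambda>z. if i = 1 then fst z else snd z)" for i :: 2
      by (cases "i = 1") (auto intro!: continuous_intros)
  qed
  also have "(\<lambda>z. (\<chi> i. if i = 1 then fst z else snd z) :: 'a ^ 2) = ?V"
    by (auto simp: fun_eq_iff vec_eq_iff forall_2 split: prod.splits)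
  finally have meas[measurable]: "?V \<in> borel_measurable borel"
    by (rule borel_measurable_continuous_onI)
  show ?thesis
  proof (rule lborel_eqI[symmetric])
    fix l u :: "'a ^ 2" assume le: "\<And>b. b \<in> Basis \<Longrightarrow> l \<bullet> b \<le> u \<bullet> b"
    have le': "l $ i \<bullet> b \<le> u $ i \<bullet> b" if "b \<in> Basis" for i b
      using le[of "axis i b"] that by (auto simp: inner_axis Basis_vec_def)
    have "emeasure (distr lborel lborel ?V) (box l u) = emeasure lborel (?V -` box l u)"
      by (subst emeasure_distr) auto
    also have "?V -` box l u = box (l $ 1) (u $ 1) \<times> box (l $ 2) (u $ 2)"
      by (auto simp: box_def Basis_vec_def inner_axis exhaust_2 forall_2)
    also have "emeasure lborel \<dots> = emeasure lborel (box (l $ 1) (u $ 1)) * emeasure lborel (box (l $ 2) (u $ 2))"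
      by (subst lborel_prod[symmetric], rule lborel.emeasure_pair_measure_Times) auto
    also have "\<dots> = ennreal (\<Prod>b\<in>Basis. (u $ 1 - l $ 1) \<bullet> b) * ennreal (\<Prod>b\<in>Basis. (u $ 2 - l $ 2) \<bullet> b)"
      using le' by simp
    also have "\<dots> = ennreal ((\<Prod>b\<in>Basis. (u $ 1 - l $ 1) \<bullet> b) * (\<Prod>b\<in>Basis. (u $ 2 - l $ 2) \<bullet> b))"
      using le' by (intro ennreal_mult[symmetric] prod_nonneg) (auto simp: inner_diff_left)
    also have "(\<Prod>b\<in>Basis. (u $ 1 - l $ 1) \<bullet> b) * (\<Prod>b\<in>Basis. (u $ 2 - l $ 2) \<bullet> b)
        = (\<Prod>b\<in>Basis. (u - l) \<bullet> b)"
    proof -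
      have inj: "inj_on (\<lambda>(i::2, b::'a). axis i b) (UNIV \<times> Basis)"
        by (auto simp: inj_on_def axis_eq_axis dest: nonzero_Basis)
      have B: "(Basis :: ('a ^ 2) set) = (\<lambda>(i, b). axis i b) ` (UNIV \<times> Basis)"
        by (auto simp: Basis_vec_def)
      have "(\<Prod>b\<in>Basis. (u - l) \<bullet> b) = (\<Prod>(i, b)\<in>UNIV \<times> Basis. (u - l) \<bullet> axis i b)"
        unfolding B by (subst prod.reindex[OF inj]) (auto simp: case_prod_beta)
      also have "\<dots> = (\<Prod>i\<in>UNIV. \<Prod>b\<in>Basis. (u $ i - l $ i) \<bullet> b)"
        by (subst prod.cartesian_product[symmetric]) (simp add: inner_axis)
      finally show ?thesis by (simp add: UNIV_2)
    qed
    finally show "emeasure (distr lborel lborel ?V) (box l u) = ennreal (\<Prod>b\<in>Basis. (u - l) \<bullet> b)" .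
  qed auto
qed

section \<open>Averages over rotations and moments\<close>

text \<open>Each \<open>T t\<close> leaves the integral of \<open>F\<close> unchanged and the
  parameter interval has length 1, so by Fubini the average has the same integral. Joint
  measurability in \<open>(t, x)\<close> is what Fubini asks for.\<close>

lemma integral_average:
  fixes F :: "'a::euclidean_space \<Rightarrow> complex"
  assumes F: "integrable lborel F"
    and T: "\<And>t. lborel_preserving (T t)"
    and meas: "(\<lambda>(t :: real, x). T t x) \<in> borel_measurable borel"
  shows "integrable lborel (\<lambda>x. LINT t:{0..1}|lborel. F (T t x))"
    and "(\<integral>x. (LINT t:{0..1}|lborel. F (T t x)) \<partial>lborel) = (\<integral>x. F x \<partial>lborel)"
proof -
  let ?H = "\<lambda>t x. indicator {0..1::real} t *\<^sub>R F (T t x)"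
  have Fm[measurable]: "F \<in> borel_measurable borel" using F by auto
  have TF: "integrable lborel (\<lambda>x. F (T t x))" for t
  proof -
    have "integrable (distr lborel lborel (T t)) F"
      using T[of t] F by (simp add: lborel_preserving_def)
    then show ?thesis
      using T[of t] by (subst (asm) integrable_distr_eq) (auto simp: lborel_preserving_def)
  qed
  have int: "integrable (lborel \<Otimes>\<^sub>M lborel) (\<lambda>(t, x). ?H t x)"
  proof (rule lborel_pair.Fubini_integrable)
    have m1: "(\<lambda>z. F (case z of (t, x) \<Rightarrow> T t x)) \<in> borel_measurable (borel :: (real \<times> 'a) measure)"
      using meas by measurable
    have "(\<lambda>z. indicator {0..1::real} (fst z) *\<^sub>R F (case z of (t, x) \<Rightarrow> T t x))
        \<in> borel_measurable (borel :: (real \<times> 'a) measure)"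
    proof (rule borel_measurable_scaleR[OF _ m1])
      have "(fst :: real \<times> 'a \<Rightarrow> real) \<in> borel_measurable borel"
        by (intro borel_measurable_continuous_onI continuous_intros)
      then show "(\<lambda>z :: real \<times> 'a. indicator {0..1::real} (fst z) :: real) \<in> borel_measurable borel"
        by (rule measurable_compose) simp
    qed
    then show "(\<lambda>(t, x). ?H t x) \<in> borel_measurable (lborel \<Otimes>\<^sub>M lborel)"
      by (simp add: lborel_prod case_prod_beta)
    have "(\<integral>x. norm (?H t x) \<partial>lborel) = indicator {0..1} t * (\<integral>x. norm (F x) \<partial>lborel)" for t
      using lborel_preserving_integral[OF T[of t], of "\<lambda>x. norm (F x)"] by simp
    then show "integrable lborel (\<lambda>t. \<integral>x. norm (case (t, x) of (t, x) \<Rightarrow> ?H t x) \<partial>lborel)"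
      by (simp only: prod.case) simp
    show "AE t in lborel. integrable lborel (\<lambda>x. case (t, x) of (t, x) \<Rightarrow> ?H t x)"
      using TF by (intro AE_I2) simp
  qed
  show "integrable lborel (\<lambda>x. LINT t:{0..1}|lborel. F (T t x))"
    using lborel_pair.integrable_snd[OF int] by (simp add: set_lebesgue_integral_def)
  have "(\<integral>x. (LINT t:{0..1}|lborel. F (T t x)) \<partial>lborel) = (\<integral>t. (\<integral>x. ?H t x \<partial>lborel) \<partial>lborel)"
    using lborel_pair.Fubini_integral[OF int] by (simp add: set_lebesgue_integral_def)
  also have "\<dots> = (\<integral>t. indicator {0..1::real} t *\<^sub>R (\<integral>x. F x \<partial>lborel) \<partial>lborel)"
    using lborel_preserving_integral[OF T Fm] by simp
  finally show "(\<integral>x. (LINT t:{0..1}|lborel. F (T t x)) \<partial>lborel) = (\<integral>x. F x \<partial>lborel)"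
    by simp
qed

section \<open>Moments of the disc, the ball and the shell\<close>

text \<open>Layer-cake argument: |z|^(2 k) is the integral of 2 k t^(2 k - 1) over 0 <= t <= |z|.
  After the integrals are exchanged, the inner one is the area of an annulus and a polynomial in
  \<open>t\<close> remains to be integrated. For \<open>k = 0\<close> the weight vanishes, so that
  case is computed as the area of a disc.\<close>

lemma nn_integral_disc_moment:
  assumes \<rho>: "0 \<le> \<rho>"
  shows "(\<integral>\<^sup>+z. ennreal (indicator (cball 0 \<rho>) z * norm (z::complex) ^ (2 * k)) \<partial>lborel)
     = ennreal (pi * \<rho> ^ (2 * k + 2) / (k + 1))"
proof (cases "k = 0")
  case True
  then show ?thesis using \<rho>
    by (simp add: emeasure_cball unit_ball_vol_2 ennreal_indicator power2_eq_square)
next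
  case False
  let ?f = "\<lambda>t::real. 2 * k * t ^ (2 * k - 1)"
  have k2: "2 * k = Suc (2 * k - 1)" using False by simp
  have layer: "ennreal (x ^ (2 * k)) = (\<integral>\<^sup>+t. ennreal (?f t) * indicator {0..x} t \<partial>lborel)" if "0 \<le> x" for x
    using that False
    by (subst nn_integral_FTC_Icc[where F = "\<lambda>t. t ^ (2 * k)"]) (auto intro!: derivative_eq_intros)
  have ind: "(\<lambda>z. indicator {(z, t). norm z \<le> \<rho> \<and> 0 \<le> t \<and> t \<le> norm z} z :: ennreal)
      \<in> borel_measurable (borel :: (complex \<times> real) measure)"
  proof -
    have "closed {(z::complex, t::real). norm z \<le> \<rho> \<and> 0 \<le> t \<and> t \<le> norm z}"
      unfolding case_prod_beta by (intro closed_Collect_conj closed_Collect_le continuous_intros)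
    then show ?thesis by (intro borel_measurable_indicator borel_closed)
  qed
  have "(\<integral>\<^sup>+z. ennreal (indicator (cball 0 \<rho>) z * norm (z::complex) ^ (2 * k)) \<partial>lborel)
      = (\<integral>\<^sup>+z. \<integral>\<^sup>+t. ennreal (?f t) * indicator {(z::complex, t). norm z \<le> \<rho> \<and> 0 \<le> t \<and> t \<le> norm z} (z, t) \<partial>lborel \<partial>lborel)"
  proof (rule nn_integral_cong)
    fix z :: complex
    have "ennreal (indicator (cball 0 \<rho>) z * norm z ^ (2 * k))
        = indicator (cball 0 \<rho>) z * (\<integral>\<^sup>+t. ennreal (?f t) * indicator {0..norm z} t \<partial>lborel)"
      by (subst layer[OF norm_ge_zero, symmetric]) (simp add: ennreal_mult ennreal_indicator)
    also have "\<dots> = (\<integral>\<^sup>+t. indicator (cball 0 \<rho>) z * (ennreal (?f t) * indicator {0..norm z} t) \<partial>lborel)"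
      by (subst nn_integral_cmult) auto
    also have "\<dots> = (\<integral>\<^sup>+t. ennreal (?f t) * indicator {(z, t). norm z \<le> \<rho> \<and> 0 \<le> t \<and> t \<le> norm z} (z, t) \<partial>lborel)"
      by (intro nn_integral_cong) (auto split: split_indicator)
    finally show "ennreal (indicator (cball 0 \<rho>) z * norm z ^ (2 * k))
      = (\<integral>\<^sup>+t. ennreal (?f t) * indicator {(z, t). norm z \<le> \<rho> \<and> 0 \<le> t \<and> t \<le> norm z} (z, t) \<partial>lborel)" .
  qed
  also have "\<dots> = (\<integral>\<^sup>+t. \<integral>\<^sup>+z. ennreal (?f t) * indicator {(z::complex, t). norm z \<le> \<rho> \<and> 0 \<le> t \<and> t \<le> norm z} (z, t) \<partial>lborel \<partial>lborel)"
  proof (rule lborel_pair.Fubini'[symmetric])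
    have "(\<lambda>z. ennreal (?f (snd z)) * indicator {(z, t). norm z \<le> \<rho> \<and> 0 \<le> t \<and> t \<le> norm z} z)
        \<in> borel_measurable (borel :: (complex \<times> real) measure)"
      by (intro borel_measurable_times_ennreal ind measurable_compose[OF _ measurable_ennreal]
          borel_measurable_continuous_onI continuous_intros)
    moreover have "(\<lambda>(z, t). ennreal (?f t) * indicator {(z::complex, t). norm z \<le> \<rho> \<and> 0 \<le> t \<and> t \<le> norm z} (z, t))
      = (\<lambda>z. ennreal (?f (snd z)) * indicator {(z, t). norm z \<le> \<rho> \<and> 0 \<le> t \<and> t \<le> norm z} z)"
      by (auto simp: fun_eq_iff)
    ultimately show "(\<lambda>(z, t). ennreal (?f t) * indicator {(z::complex, t). norm z \<le> \<rho> \<and> 0 \<le> t \<and> t \<le> norm z} (z, t))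
        \<in> borel_measurable (lborel \<Otimes>\<^sub>M (lborel :: real measure))"
      by (simp only: lborel_prod measurable_lborel1 measurable_lborel2)
  qed
  also have "\<dots> = (\<integral>\<^sup>+t. ennreal (?f t * (pi * (\<rho>\<^sup>2 - t\<^sup>2))) * indicator {0..\<rho>} t \<partial>lborel)"
  proof (rule nn_integral_cong)
    fix t :: real
    show "(\<integral>\<^sup>+z. ennreal (?f t) * indicator {(z::complex, t). norm z \<le> \<rho> \<and> 0 \<le> t \<and> t \<le> norm z} (z, t) \<partial>lborel)
       = ennreal (?f t * (pi * (\<rho>\<^sup>2 - t\<^sup>2))) * indicator {0..\<rho>} t"
    proof (cases "0 \<le> t \<and> t \<le> \<rho>")
      case True
      have "(\<integral>\<^sup>+z. ennreal (?f t) * indicator {(z::complex, t). norm z \<le> \<rho> \<and> 0 \<le> t \<and> t \<le> norm z} (z, t) \<partial>lborel)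
         = (\<integral>\<^sup>+z. ennreal (?f t) * indicator (cball 0 \<rho> - ball 0 t :: complex set) z \<partial>lborel)"
        using True by (intro nn_integral_cong) (auto split: split_indicator)
      also have "\<dots> = ennreal (?f t) * emeasure lborel (cball 0 \<rho> - ball 0 t :: complex set)"
        by (subst nn_integral_cmult_indicator) auto
      also have "emeasure lborel (cball 0 \<rho> - ball 0 t :: complex set) = ennreal (pi * \<rho>\<^sup>2) - ennreal (pi * t\<^sup>2)"
        using True by (subst emeasure_Diff) (auto simp: emeasure_cball emeasure_ball unit_ball_vol_2)
      also have "\<dots> = ennreal (pi * (\<rho>\<^sup>2 - t\<^sup>2))"
        using True by (subst ennreal_minus) (auto simp: algebra_simps)
      finally show ?thesis using True
        by (subst ennreal_mult) (auto intro!: mult_nonneg_nonneg power_mono)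
    next
      case False
      then have "indicator {(z::complex, t). norm z \<le> \<rho> \<and> 0 \<le> t \<and> t \<le> norm z} (z, t) = (0::ennreal)" for z
        by (auto split: split_indicator)
      with False show ?thesis by simp
    qed
  qed
  \<comment> \<open>The two terms are the values of an antiderivative at \<open>\<rho>\<close> and
    at 0; the latter vanishes because \<open>k\<close> is positive here.\<close>
  also have "\<dots> = ennreal (pi * (\<rho>\<^sup>2 * \<rho> ^ (2 * k) - k / (k + 1) * \<rho> ^ (2 * k + 2))
      - pi * (\<rho>\<^sup>2 * 0 ^ (2 * k) - k / (k + 1) * 0 ^ (2 * k + 2)))"
  proof (rule nn_integral_FTC_Icc[OF _ _ _ \<rho>])
    fix t assume "t \<in> {0..\<rho>}"
    then have t: "0 \<le> t" "t \<le> \<rho>" by auto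
    have p: "t ^ (2 * k + 1) = t ^ (2 * k - 1) * t\<^sup>2"
      using False by (simp flip: power_add)
    have c: "real k / real (k + 1) * real (2 * k + 2) = 2 * k"
      by (simp add: field_simps)
    have "((\<lambda>t. pi * (\<rho>\<^sup>2 * t ^ (2 * k) - k / (k + 1) * t ^ (2 * k + 2))) has_real_derivative
       pi * (\<rho>\<^sup>2 * (real (2 * k) * t ^ (2 * k - 1)) - k / (k + 1) * (real (2 * k + 2) * t ^ (2 * k + 1))))
       (at t)"
      by (intro DERIV_cmult DERIV_diff DERIV_cong[OF DERIV_pow]) simp_all
    also have "pi * (\<rho>\<^sup>2 * (real (2 * k) * t ^ (2 * k - 1)) - k / (k + 1) * (real (2 * k + 2) * t ^ (2 * k + 1)))
       = ?f t * (pi * (\<rho>\<^sup>2 - t\<^sup>2))"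
      unfolding p mult.assoc[symmetric] c by (simp add: algebra_simps)
    finally show "((\<lambda>t. pi * (\<rho>\<^sup>2 * t ^ (2 * k) - k / (k + 1) * t ^ (2 * k + 2)))
        has_real_derivative ?f t * (pi * (\<rho>\<^sup>2 - t\<^sup>2))) (at t)" .
    show "0 \<le> ?f t * (pi * (\<rho>\<^sup>2 - t\<^sup>2))"
      using t by (auto intro!: mult_nonneg_nonneg power_mono)
  qed auto
  also have "pi * (\<rho>\<^sup>2 * \<rho> ^ (2 * k) - k / (k + 1) * \<rho> ^ (2 * k + 2))
      - pi * (\<rho>\<^sup>2 * 0 ^ (2 * k) - k / (k + 1) * 0 ^ (2 * k + 2)) = pi * \<rho> ^ (2 * k + 2) / (k + 1)"
    using False by (simp add: field_simps power_add power2_eq_square power_0_left)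
  finally show ?thesis .
qed

lemma has_bochner_integral_disc_moment:
  assumes "0 \<le> \<rho>"
  shows "has_bochner_integral lborel (\<lambda>z::complex. indicator (cball 0 \<rho>) z * norm z ^ (2 * k))
     (pi * \<rho> ^ (2 * k + 2) / (k + 1))"
proof (rule has_bochner_integral_nn_integral[OF _ _ _ nn_integral_disc_moment[OF assms]])
  show "(\<lambda>z::complex. indicator (cball 0 \<rho>) z * norm z ^ (2 * k)) \<in> borel_measurable lborel"
    unfolding measurable_lborel1 measurable_lborel2
    by (intro borel_measurable_times borel_measurable_indicator borel_closed
        borel_measurable_continuous_onI continuous_intros closed_cball)
qed (use assms in \<open>auto simp: indicator_def\<close>)

text \<open>Over a fixed first coordinate x the second one ranges over a disc of area pi (\<rho>^2 -
  |x|^2), so the moment is a difference of disc moments of orders k and k + 1.\<close>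

lemma has_bochner_integral_cball_moment:
  assumes \<rho>: "0 \<le> \<rho>"
  shows "has_bochner_integral lborel
     (\<lambda>z::complex \<times> complex. indicator (cball 0 \<rho>) z * norm (fst z) ^ (2 * k))
     (pi\<^sup>2 * \<rho> ^ (2 * k + 4) / ((k + 1) * (k + 2)))"
proof (rule has_bochner_integral_nn_integral)
  let ?f = "\<lambda>z::complex \<times> complex. indicator (cball 0 \<rho>) z * norm (fst z) ^ (2 * k)"
  show fm: "?f \<in> borel_measurable lborel"
    unfolding measurable_lborel1 measurable_lborel2
    by (intro borel_measurable_times borel_measurable_indicator borel_closed
        borel_measurable_continuous_onI continuous_intros closed_cball)
  have "(\<integral>\<^sup>+z. ennreal (?f z) \<partial>lborel) = (\<integral>\<^sup>+x. \<integral>\<^sup>+y. ennreal (?f (x, y)) \<partial>lborel \<partial>lborel)"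
    by (subst (1) lborel_prod[symmetric], subst lborel.nn_integral_fst) (use fm in \<open>auto simp: lborel_prod\<close>)
  also have "\<dots> = (\<integral>\<^sup>+x. ennreal (pi * \<rho>\<^sup>2 * (indicator (cball 0 \<rho>) (x::complex) * norm x ^ (2 * k))
       - pi * (indicator (cball 0 \<rho>) x * norm x ^ (2 * (k + 1)))) \<partial>lborel)"
  proof (rule nn_integral_cong)
    fix x :: complex
    show "(\<integral>\<^sup>+y. ennreal (?f (x, y)) \<partial>lborel)
       = ennreal (pi * \<rho>\<^sup>2 * (indicator (cball 0 \<rho>) x * norm x ^ (2 * k))
       - pi * (indicator (cball 0 \<rho>) x * norm x ^ (2 * (k + 1))))"
    proof (cases "norm x \<le> \<rho>")
      case True
      then have x2: "(norm x)\<^sup>2 \<le> \<rho>\<^sup>2" by (intro power_mono) auto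
      have iff: "(x, y) \<in> cball 0 \<rho> \<longleftrightarrow> y \<in> cball 0 (sqrt (\<rho>\<^sup>2 - (norm x)\<^sup>2))" for y :: complex
      proof -
        have "(x, y) \<in> cball 0 \<rho> \<longleftrightarrow> sqrt ((norm x)\<^sup>2 + (norm y)\<^sup>2) \<le> \<rho>"
          by (simp add: norm_Pair)
        also have "\<dots> \<longleftrightarrow> (norm x)\<^sup>2 + (norm y)\<^sup>2 \<le> \<rho>\<^sup>2"
          using \<rho> by (simp add: real_sqrt_le_iff' real_le_lsqrt sqrt_le_D)
        also have "\<dots> \<longleftrightarrow> norm y \<le> sqrt (\<rho>\<^sup>2 - (norm x)\<^sup>2)"
        proof
          assume "(norm x)\<^sup>2 + (norm y)\<^sup>2 \<le> \<rho>\<^sup>2"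
          then show "norm y \<le> sqrt (\<rho>\<^sup>2 - (norm x)\<^sup>2)" by (intro real_le_rsqrt) auto
        next
          assume "norm y \<le> sqrt (\<rho>\<^sup>2 - (norm x)\<^sup>2)"
          then have "(norm y)\<^sup>2 \<le> (sqrt (\<rho>\<^sup>2 - (norm x)\<^sup>2))\<^sup>2" by (intro power_mono) auto
          then show "(norm x)\<^sup>2 + (norm y)\<^sup>2 \<le> \<rho>\<^sup>2" using x2 by simp
        qed
        finally show ?thesis by simp
      qed
      have "(\<integral>\<^sup>+y. ennreal (?f (x, y)) \<partial>lborel)
         = (\<integral>\<^sup>+y. ennreal (norm x ^ (2 * k)) * indicator (cball 0 (sqrt (\<rho>\<^sup>2 - (norm x)\<^sup>2))) (y::complex) \<partial>lborel)"
        using iff by (intro nn_integral_cong) (auto simp: indicator_def)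
      also have "\<dots> = ennreal (norm x ^ (2 * k)) * ennreal (pi * (\<rho>\<^sup>2 - (norm x)\<^sup>2))"
        using x2 by (subst nn_integral_cmult_indicator) (auto simp: emeasure_cball unit_ball_vol_2)
      also have "\<dots> = ennreal (norm x ^ (2 * k) * (pi * (\<rho>\<^sup>2 - (norm x)\<^sup>2)))"
        using x2 by (subst ennreal_mult) auto
      also have "norm x ^ (2 * k) * (pi * (\<rho>\<^sup>2 - (norm x)\<^sup>2)) =
        pi * \<rho>\<^sup>2 * (indicator (cball 0 \<rho>) x * norm x ^ (2 * k))
       - pi * (indicator (cball 0 \<rho>) x * norm x ^ (2 * (k + 1)))"
        using True by (simp add: algebra_simps power_add power2_eq_square)
      finally show ?thesis .
    next
      case False
      have f0: "?f (x, y) = 0" for y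
        using False norm_fst_le[of x y] by (auto simp: indicator_def)
      show ?thesis unfolding f0 using False by simp
    qed
  qed
  also have "\<dots> = ennreal (pi * \<rho>\<^sup>2 * (pi * \<rho> ^ (2 * k + 2) / (k + 1)) - pi * (pi * \<rho> ^ (2 * (k + 1) + 2) / ((k + 1) + 1)))"
  proof -
    have I: "has_bochner_integral lborel (\<lambda>x::complex. pi * \<rho>\<^sup>2 * (indicator (cball 0 \<rho>) x * norm x ^ (2 * k))
       - pi * (indicator (cball 0 \<rho>) x * norm x ^ (2 * (k + 1))))
       (pi * \<rho>\<^sup>2 * (pi * \<rho> ^ (2 * k + 2) / (k + 1)) - pi * (pi * \<rho> ^ (2 * (k + 1) + 2) / ((k + 1) + 1)))"
      using has_bochner_integral_disc_moment[OF \<rho>, of k] has_bochner_integral_disc_moment[OF \<rho>, of "k + 1"]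
      by (intro has_bochner_integral_diff has_bochner_integral_mult_right) auto
    have "0 \<le> pi * \<rho>\<^sup>2 * (indicator (cball 0 \<rho>) x * norm x ^ (2 * k))
       - pi * (indicator (cball 0 \<rho>) x * norm x ^ (2 * (k + 1)))" for x :: complex
      using \<rho> by (auto simp: indicator_def power_add power2_eq_square mult_mono intro!: mult_right_mono mult_left_mono)
    with I show ?thesis
      by (subst nn_integral_eq_integral) (auto simp: has_bochner_integral_iff)
  qed
  also have "pi * \<rho>\<^sup>2 * (pi * \<rho> ^ (2 * k + 2) / (k + 1)) - pi * (pi * \<rho> ^ (2 * (k + 1) + 2) / ((k + 1) + 1))
      = pi\<^sup>2 * \<rho> ^ (2 * k + 4) / ((k + 1) * (k + 2))"
    by (simp add: field_simps power_add power2_eq_square power4_eq_xxxx)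
  finally show "(\<integral>\<^sup>+z. ennreal (?f z) \<partial>lborel) = ennreal (pi\<^sup>2 * \<rho> ^ (2 * k + 4) / ((k + 1) * (k + 2)))" .
qed (use \<rho> in \<open>auto simp: indicator_def\<close>)

text \<open>For \<open>r < 0\<close> this is the unit ball, which is thereby treated along with the shells; hence the
  \<open>max 0 r\<close> below.\<close>

definition pair_shell :: "real \<Rightarrow> (complex \<times> complex) set"
  where "pair_shell r = {z. r < norm z \<and> norm z < 1}"

text \<open>The moment of the closed unit ball minus that of the closed ball of radius
  \<open>max 0 r\<close>. The difference of these balls agrees with the shell up to the unit sphere
  and, for \<open>r < 0\<close>, the origin; both are null sets.\<close>

lemma has_bochner_integral_shell_moment:
  assumes r: "r < 1"
  shows "has_bochner_integral lborel
     (\<lambda>z. indicator (pair_shell r) z * norm (fst z) ^ (2 * k))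
     (pi\<^sup>2 * (1 - max 0 r ^ (2 * k + 4)) / ((k + 1) * (k + 2)))"
proof -
  let ?R = "max 0 r"
  let ?f = "\<lambda>z::complex \<times> complex. norm (fst z) ^ (2 * k)"
  have I: "has_bochner_integral lborel (\<lambda>z. indicator (cball 0 1) z * ?f z - indicator (cball 0 ?R) z * ?f z)
     (pi\<^sup>2 * 1 ^ (2 * k + 4) / ((k + 1) * (k + 2)) - pi\<^sup>2 * ?R ^ (2 * k + 4) / ((k + 1) * (k + 2)))"
    by (intro has_bochner_integral_diff has_bochner_integral_cball_moment) auto
  have "has_bochner_integral lborel
     (\<lambda>z. indicator (pair_shell r) z * ?f z)
     (pi\<^sup>2 * 1 ^ (2 * k + 4) / ((k + 1) * (k + 2)) - pi\<^sup>2 * ?R ^ (2 * k + 4) / ((k + 1) * (k + 2)))"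
  proof (rule has_bochner_integralI_AE[OF I])
    have "?f \<in> borel_measurable borel"
      by (intro borel_measurable_continuous_onI continuous_intros)
    moreover have "open (pair_shell r)"
      unfolding pair_shell_def by (intro open_Collect_conj open_Collect_less continuous_intros)
    ultimately show "(\<lambda>z. indicator (pair_shell r) z * ?f z) \<in> borel_measurable lborel"
      unfolding measurable_lborel1 measurable_lborel2 by (intro borel_measurable_times borel_measurable_indicator borel_open)
    have "AE z in lborel. z \<notin> sphere 0 (1::real)"
      by (intro AE_not_in) (use negligible_sphere in \<open>auto simp: null_sets_completion_iff negligible_iff_null_sets negligible_convex_frontier\<close>)
    moreover have "AE z in lborel. z \<notin> {0::complex \<times> complex}"
      by (intro AE_not_in) auto
    ultimately show "AE z in lborel. indicator (cball 0 1) z * ?f z - indicator (cball 0 ?R) z * ?f z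
       = indicator (pair_shell r) z * ?f z"
      by eventually_elim (use r in \<open>auto simp: indicator_def pair_shell_def max_def split: if_splits dest: order_trans[OF norm_ge_zero]\<close>)
  qed
  then show ?thesis
    by (simp add: algebra_simps diff_divide_distrib)
qed

section \<open>Circle averages of holomorphic functions\<close>

text \<open>The parameter runs over [0, 1], so that a mean over the circle is a plain integral and
  the parametrisation agrees with \<open>circlepath\<close>.\<close>

abbreviation circ :: "real \<Rightarrow> complex"
  where "circ t \<equiv> cis (2 * pi * t)"

lemma circ_eq_exp: "circ t = exp (2 * of_real pi * \<i> * of_real t)"
  by (simp add: cis_conv_exp algebra_simps)

lemma circlepath_eq_circ: "circlepath z r = (\<lambda>t. z + r * circ t)"
  by (simp add: circlepath circ_eq_exp)

lemma has_vector_derivative_circ: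
  "(circ has_vector_derivative (2 * pi * \<i> * circ t)) (at t within S)"
  using has_vector_derivative_circlepath[of 0 1 t S] by (simp add: circlepath_eq_circ circ_eq_exp)

lemma has_contour_integral_circlepath_circ:
  "(f has_contour_integral I) (circlepath z r) \<longleftrightarrow>
   ((\<lambda>t. f (z + r * circ t) * (2 * pi * \<i> * r * circ t)) has_integral I) {0..1}"
  unfolding has_contour_integral
  by (simp add: circlepath_eq_circ vector_derivative_circlepath[unfolded circlepath_eq_circ] flip: circ_eq_exp)

text \<open>Differentiation under the integral sign in the base point \<open>b\<close> gives the
  mean of \<open>deriv h (b * circ t) * circ t\<close>. Up to a factor this integrand is the
  derivative of \<open>h (b * circ t)\<close> in \<open>t\<close>, so it integrates to 0 over the
  closed circle, and the mean is constant on the connected set \<open>U\<close>.\<close>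

lemma circle_average_constant:
  fixes h :: "complex \<Rightarrow> complex"
  assumes h: "h holomorphic_on U" and U: "open U" "connected U"
    and rot: "\<And>u t. u \<in> U \<Longrightarrow> u * circ t \<in> U"
    and bc: "b \<in> U" "c \<in> U"
  shows "integral {0..1} (\<lambda>t. h (b * circ t)) = integral {0..1} (\<lambda>t. h (c * circ t))"
proof -
  have contd: "continuous_on U (deriv h)"
    using h U by (intro holomorphic_on_imp_continuous_on holomorphic_deriv)
  have h': "(h has_field_derivative deriv h x) (at x)" if "x \<in> U" for x
    using h U that by (intro holomorphic_derivI)
  have "((\<lambda>b. integral {0..1} (\<lambda>t. h (b * circ t))) has_field_derivative 0) (at b)"
    if b: "b \<in> U" for b
  proof -
    obtain \<delta> where \<delta>: "0 < \<delta>" "ball b \<delta> \<subseteq> U"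
      using U b open_contains_ball by blast
    have "((\<lambda>b. integral (cbox 0 1) (\<lambda>t. h (b * circ t))) has_field_derivative
        integral (cbox 0 1) (\<lambda>t. deriv h (b * circ t) * circ t)) (at b within ball b \<delta>)"
    proof (rule leibniz_rule_field_derivative)
      fix x t assume "x \<in> ball b \<delta>"
      then have "x * circ t \<in> U" using \<delta> rot by blast
      then show "((\<lambda>x. h (x * circ t)) has_field_derivative deriv h (x * circ t) * circ t) (at x within ball b \<delta>)"
        by (intro DERIV_chain'[where f="\<lambda>x. x * circ t" and g=h] h') (auto intro!: derivative_eq_intros)
    next
      fix x assume "x \<in> ball b \<delta>"
      then have x: "x \<in> U" using \<delta> by blast
      have "continuous_on {0..1} (\<lambda>t. h (x * circ t))"
        by (rule continuous_on_compose2[OF holomorphic_on_imp_continuous_on[OF h]])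
          (use x rot in \<open>auto intro!: continuous_intros\<close>)
      then show "(\<lambda>t. h (x * circ t)) integrable_on cbox 0 1"
        by (simp add: integrable_continuous_real)
    next
      show "continuous_on (ball b \<delta> \<times> cbox 0 1) (\<lambda>(x, t). deriv h (x * circ t) * circ t)"
        unfolding case_prod_beta
        by (intro continuous_intros continuous_on_compose2[OF contd]) (use \<delta> rot in auto)
    qed (use \<delta> in auto)
    moreover have "integral (cbox 0 1) (\<lambda>t. deriv h (b * circ t) * circ t) = 0"
    proof (cases "b = 0")
      case True
      have "((\<lambda>t. 2 * pi * \<i> * circ t) has_integral (circ 1 - circ 0)) {0..1}"
        by (intro fundamental_theorem_of_calculus has_vector_derivative_circ) auto
      from has_integral_mult_right[OF this, of "1 / (2 * pi * \<i>)"]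
      have "(circ has_integral 0) {0..1}" by simp
      then have "integral {0..1} circ = 0" by (rule integral_unique)
      with True show ?thesis by simp
    next
      case False
      have "((\<lambda>t. deriv h (b * circ t) * (b * (2 * pi * \<i> * circ t)))
          has_integral (h (b * circ 1) - h (b * circ 0))) {0..1}"
      proof (rule fundamental_theorem_of_calculus)
        fix t :: real
        have "((\<lambda>t. b * circ t) has_vector_derivative b * (2 * pi * \<i> * circ t)) (at t within {0..1})"
          by (intro has_vector_derivative_mult_right has_vector_derivative_circ)
        from field_vector_diff_chain_within[OF this, of h "deriv h (b * circ t)"]
        show "((\<lambda>t. h (b * circ t)) has_vector_derivative deriv h (b * circ t) * (b * (2 * pi * \<i> * circ t)))
           (at t within {0..1})"
          using h'[of "b * circ t"] rot b by (simp add: o_def has_field_derivative_at_within mult.commute)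
      qed simp
      from has_integral_mult_right[OF this, of "1 / (b * (2 * pi * \<i>))"]
      have "((\<lambda>t. 1 / (b * (2 * pi * \<i>)) * (deriv h (b * circ t) * (b * (2 * pi * \<i> * circ t))))
          has_integral 0) {0..1}"
        by simp
      moreover have "1 / (b * (2 * pi * \<i>)) * (deriv h (b * circ t) * (b * (2 * pi * \<i> * circ t)))
         = deriv h (b * circ t) * circ t" for t
        using False by (simp add: field_simps)
      ultimately have "((\<lambda>t. deriv h (b * circ t) * circ t) has_integral 0) {0..1}" by simp
      then show ?thesis by (simp add: integral_unique)
    qed
    ultimately show ?thesis
      using \<delta>(1) at_within_open[of b "ball b \<delta>"] by simp
  qed
  from has_field_derivative_0_imp_constant_on[OF this U(2,1)] bc show ?thesis
    unfolding constant_on_def by auto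
qed

text \<open>Cauchy's formula on the unit circle for \<open>\<lambda>u. G (z * u)\<close>, whose k-th
  derivative at 0 contributes the factor \<open>z ^ k\<close>. Since |z| < 1, this function is
  holomorphic on a disc of some radius \<open>\<rho> > 1\<close>, which contains the closed unit
  disc.\<close>

lemma holomorphic_circle_coefficient:
  assumes G: "G holomorphic_on ball 0 1" and z: "norm z < 1"
  shows "((\<lambda>t. G (z * circ t) / circ t ^ k) has_integral ((deriv ^^ k) G 0 / fact k * z ^ k)) {0..1}"
proof -
  obtain \<rho> where \<rho>: "1 < \<rho>" "norm z * \<rho> < 1"
  proof (cases "z = 0")
    case True then show ?thesis by (intro that[of 2]) auto
  next
    case False
    then have "1 < 1 / norm z" using z by simp
    from dense[OF this] obtain \<rho> where "1 < \<rho>" "\<rho> < 1 / norm z" by blast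
    with False show ?thesis by (intro that[of \<rho>]) (auto simp: field_simps)
  qed
  have zu: "z * u \<in> ball 0 1" if "u \<in> ball 0 \<rho>" for u
    using that \<rho> mult_left_mono[of "norm u" \<rho> "norm z"] by (simp add: norm_mult)
  have H: "(\<lambda>u. G (z * u)) holomorphic_on ball 0 \<rho>"
    using holomorphic_on_compose_gen[OF _ G, of "\<lambda>u. z * u" "ball 0 \<rho>"] zu
    by (simp add: o_def image_subset_iff holomorphic_on_mult holomorphic_on_ident)
  have sub: "cball 0 1 \<subseteq> ball 0 \<rho>" using \<rho> by auto
  have "((\<lambda>u. G (z * u) / (u - 0) ^ Suc k) has_contour_integral
     (2 * pi * \<i>) / fact k * (deriv ^^ k) (\<lambda>u. G (z * u)) 0) (circlepath 0 1)"
  proof (rule Cauchy_has_contour_integral_higher_derivative_circlepath)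
    show "continuous_on (cball 0 1) (\<lambda>u. G (z * u))"
      using sub by (intro holomorphic_on_imp_continuous_on holomorphic_on_subset[OF H])
    show "(\<lambda>u. G (z * u)) holomorphic_on ball 0 1"
      by (rule holomorphic_on_subset[OF H]) (use sub in auto)
  qed simp
  also have "(deriv ^^ k) (\<lambda>u. G (z * u)) 0 = z ^ k * (deriv ^^ k) G 0"
    using higher_deriv_compose_linear[OF G, of "ball 0 \<rho>" 0 z k] \<rho> zu by simp
  finally have "((\<lambda>t. G (z * circ t) / circ t ^ Suc k * (2 * pi * \<i> * circ t)) has_integral
     (2 * pi * \<i>) / fact k * (z ^ k * (deriv ^^ k) G 0)) {0..1}"
    by (simp add: has_contour_integral_circlepath_circ)
  from has_integral_mult_right[OF this, of "1 / (2 * pi * \<i>)"]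
  show ?thesis by (simp add: field_simps)
qed

text \<open>Exchanging the parameter integral with the circle integral carries Cauchy's formula from
  the functions \<open>\<lambda>x. F x t\<close> over to their mean, and a Cauchy integral of
  continuous boundary values is differentiable.\<close>

lemma holomorphic_parametric_integral:
  fixes F :: "complex \<Rightarrow> real \<Rightarrow> complex"
  assumes cont: "continuous_on (cball a \<delta> \<times> {0..1}) (\<lambda>(x, t). F x t)"
    and hol: "\<And>t. t \<in> {0..1} \<Longrightarrow> (\<lambda>x. F x t) holomorphic_on ball a \<delta>"
    and \<delta>: "0 < \<delta>"
  shows "(\<lambda>x. integral {0..1} (F x)) holomorphic_on ball a \<delta>"
proof -
  let ?M = "\<lambda>x. integral {0..1} (F x)"
  have contM: "continuous_on (cball a \<delta>) ?M"
    using integral_continuous_on_param[of "cball a \<delta>" 0 1 F] cont by simp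
  have contFt: "continuous_on (cball a \<delta>) (\<lambda>x. F x t)" if "t \<in> {0..1}" for t
  proof -
    have "continuous_on (cball a \<delta>) (\<lambda>x. case (x, t) of (x, t) \<Rightarrow> F x t)"
      by (rule continuous_on_compose2[OF cont]) (use that in \<open>auto intro!: continuous_intros\<close>)
    then show ?thesis by simp
  qed
  have pin: "a + \<delta> * circ s \<in> cball a \<delta>" for s
    using \<delta> by (simp add: dist_norm norm_mult)
  \<comment> \<open>The exponent 1 is kept visible to match the form of
    \<open>Cauchy_next_derivative_circlepath\<close>.\<close>
  have int: "((\<lambda>u. ?M u / (u - w) ^ 1) has_contour_integral (2 * pi * \<i> * ?M w)) (circlepath a \<delta>)"
    if w: "w \<in> ball a \<delta>" for w
  proof -
    have ne: "a + \<delta> * circ s \<noteq> w" for s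
    proof
      assume "a + \<delta> * circ s = w"
      then have "w - a = \<delta> * circ s" by auto
      then have "norm (w - a) = \<delta>" using \<delta> by (simp add: norm_mult)
      with w show False by (simp add: dist_norm norm_minus_commute)
    qed
    let ?q = "\<lambda>s. (2 * pi * \<i> * \<delta> * circ s) / (a + \<delta> * circ s - w)"
    have ctbl: "(\<lambda>u. ?M u / (u - w) ^ 1) contour_integrable_on (circlepath a \<delta>)"
    proof (rule contour_integrable_continuous_circlepath)
      show "continuous_on (path_image (circlepath a \<delta>)) (\<lambda>u. ?M u / (u - w) ^ 1)"
        by (intro continuous_intros continuous_on_subset[OF contM])
          (use ne \<delta> in \<open>auto simp: path_image_def circlepath_eq_circ dist_norm norm_mult\<close>)
    qed
    have contFq: "continuous_on (cbox (0, 0) (1, 1)) (\<lambda>(s, t). F (a + \<delta> * circ s) t * ?q s)"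
      unfolding case_prod_beta using ne pin
      by (intro continuous_intros continuous_on_compose2[OF cont[unfolded case_prod_beta],
            of _ "\<lambda>z. (a + \<delta> * circ (fst z), snd z)", simplified]) auto
    have Fint: "(\<lambda>t. F x t) integrable_on {0..1}" if "x \<in> cball a \<delta>" for x
    proof -
      have "continuous_on {0..1} (\<lambda>t. case (x, t) of (x, t) \<Rightarrow> F x t)"
        by (rule continuous_on_compose2[OF cont]) (use that in \<open>auto intro!: continuous_intros\<close>)
      then show ?thesis by (simp add: integrable_continuous_real)
    qed
    have "contour_integral (circlepath a \<delta>) (\<lambda>u. ?M u / (u - w) ^ 1)
        = integral {0..1} (\<lambda>s. ?M (a + \<delta> * circ s) * ?q s)"
      unfolding contour_integral_integral vector_derivative_circlepath circ_eq_exp[symmetric]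
      by (simp add: circlepath_eq_circ algebra_simps)
    also have "\<dots> = integral (cbox 0 1) (\<lambda>s. integral (cbox 0 1) (\<lambda>t. F (a + \<delta> * circ s) t * ?q s))"
      using Fint[OF pin] by (simp add: integral_mult_left)
    also have "\<dots> = integral (cbox 0 1) (\<lambda>t. integral (cbox 0 1) (\<lambda>s. F (a + \<delta> * circ s) t * ?q s))"
      by (rule integral_swap_continuous[OF contFq])
    also have "\<dots> = integral {0..1} (\<lambda>t. 2 * pi * \<i> * F w t)"
      unfolding cbox_interval
    proof (rule integral_cong)
      fix t :: real assume t: "t \<in> {0..1}"
      have "((\<lambda>u. F u t / (u - w)) has_contour_integral (2 * of_real pi * \<i> * F w t)) (circlepath a \<delta>)"
        using w t by (intro Cauchy_integral_circlepath contFt hol) (auto simp: dist_norm norm_minus_commute)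
      then show "integral {0..1} (\<lambda>s. F (a + \<delta> * circ s) t * ?q s) = 2 * pi * \<i> * F w t"
        unfolding has_contour_integral_circlepath_circ by (simp add: integral_unique algebra_simps)
    qed
    also have "\<dots> = 2 * pi * \<i> * ?M w"
      by simp
    finally show ?thesis
      using ctbl by (metis has_contour_integral_integral)
  qed
  have "?M field_differentiable at w" if w: "w \<in> ball a \<delta>" for w
  proof -
    have "continuous_on (path_image (circlepath a \<delta>)) ?M"
      using \<delta> by (intro continuous_on_subset[OF contM]) auto
    from Cauchy_next_derivative_circlepath(2)[OF this int _ w]
    have "(\<lambda>w. 2 * pi * \<i> * ?M w) field_differentiable at w"
      unfolding field_differentiable_def by auto
    from field_differentiable_mult[OF field_differentiable_const this, of "1 / (2 * pi * \<i>)"]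
    show ?thesis by simp
  qed
  then show ?thesis
    by (simp add: holomorphic_on_def field_differentiable_at_within)
qed

section \<open>Holomorphic functions on the shell and their Hartogs extension\<close>

text \<open>The counterpart of \<open>holomorphic_vec_on\<close> for pairs, with the complex-linear
  derivative written through its partial derivatives \<open>A\<close> and \<open>B\<close>. The
  unrestricted filter \<open>at z\<close> suits the open shells.\<close>

definition pair_holomorphic :: "(complex \<times> complex \<Rightarrow> complex) \<Rightarrow> (complex \<times> complex) set \<Rightarrow> bool"
  where "pair_holomorphic f D \<longleftrightarrow>
    (\<forall>z\<in>D. \<exists>A B. (f has_derivative (\<lambda>h. A * fst h + B * snd h)) (at z))"

lemma pair_holomorphic_fst:
  assumes "pair_holomorphic f D" "\<And>x. x \<in> S \<Longrightarrow> (x, b) \<in> D"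
  shows "(\<lambda>x. f (x, b)) holomorphic_on S"
proof -
  have "(\<lambda>x. f (x, b)) field_differentiable at x" if x: "x \<in> S" for x
  proof -
    obtain A B where d: "(f has_derivative (\<lambda>h. A * fst h + B * snd h)) (at (x, b))"
      using assms x unfolding pair_holomorphic_def by blast
    have "((\<lambda>x. (x, b)) has_derivative (\<lambda>h. (h, 0))) (at x)"
      by (auto intro!: derivative_eq_intros)
    from has_derivative_compose[OF this, of f "\<lambda>h. A * fst h + B * snd h"] d
    have "((\<lambda>x. f (x, b)) has_derivative (\<lambda>h. A * h)) (at x)"
      by simp
    then show ?thesis
      unfolding field_differentiable_def has_field_derivative_def by blast
  qed
  then show ?thesis by (simp add: holomorphic_on_def field_differentiable_at_within)
qed

lemma pair_holomorphic_snd: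
  assumes "pair_holomorphic f D" "\<And>y. y \<in> S \<Longrightarrow> (a, y) \<in> D"
  shows "(\<lambda>y. f (a, y)) holomorphic_on S"
proof -
  have "(\<lambda>y. f (a, y)) field_differentiable at y" if y: "y \<in> S" for y
  proof -
    obtain A B where d: "(f has_derivative (\<lambda>h. A * fst h + B * snd h)) (at (a, y))"
      using assms y unfolding pair_holomorphic_def by blast
    have "((\<lambda>y. (a, y)) has_derivative (\<lambda>h. (0, h))) (at y)"
      by (auto intro!: derivative_eq_intros)
    from has_derivative_compose[OF this, of f "\<lambda>h. A * fst h + B * snd h"] d
    have "((\<lambda>y. f (a, y)) has_derivative (\<lambda>h. B * h)) (at y)"
      by simp
    then show ?thesis
      unfolding field_differentiable_def has_field_derivative_def by blast
  qed
  then show ?thesis by (simp add: holomorphic_on_def field_differentiable_at_within)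
qed

lemma pair_holomorphic_continuous_on:
  assumes "pair_holomorphic f D"
  shows "continuous_on D f"
  using assms unfolding pair_holomorphic_def
  by (meson continuous_at_imp_continuous_on has_derivative_continuous)

lemma open_pair_shell: "open (pair_shell r)"
  unfolding pair_shell_def by (intro open_Collect_conj open_Collect_less continuous_intros)

lemma pair_shell_rotate [simp]:
  "(x * circ t, y) \<in> pair_shell r \<longleftrightarrow> (x, y) \<in> pair_shell r"
  "(x, y * circ t) \<in> pair_shell r \<longleftrightarrow> (x, y) \<in> pair_shell r"
  by (simp_all add: pair_shell_def norm_Pair norm_mult)

text \<open>Pythagoras. For \<open>r < norm a\<close> the slice is a full disc, which the negative
  lower bound \<open>lo = -1\<close> encodes. In this form the slices are seen to be open and
  connected.\<close>

lemma pair_shell_slice: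
  assumes "norm a < 1"
  obtains lo hi where "{y. (a, y) \<in> pair_shell r} = {y. lo < norm y \<and> norm y < hi}"
proof -
  have hi: "norm (a, y) < 1 \<longleftrightarrow> norm y < sqrt (1 - (norm a)\<^sup>2)" for y :: complex
  proof -
    have "norm (a, y) < 1 \<longleftrightarrow> (norm a)\<^sup>2 + (norm y)\<^sup>2 < 1"
      by (simp add: norm_Pair)
    also have "\<dots> \<longleftrightarrow> sqrt ((norm y)\<^sup>2) < sqrt (1 - (norm a)\<^sup>2)"
      unfolding real_sqrt_less_iff by auto
    finally show ?thesis by simp
  qed
  show thesis
  proof (cases "r < norm a")
    case True
    then have "r < norm (a, y)" for y
      using norm_fst_le[of a y] by simp
    then show thesis
      using hi by (intro that[of "-1" "sqrt (1 - (norm a)\<^sup>2)"])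
        (auto simp: pair_shell_def intro: less_le_trans[OF _ norm_ge_zero])
  next
    case False
    then have r: "0 \<le> r" "norm a \<le> r" using norm_ge_zero[of a] by linarith+
    have lo: "r < norm (a, y) \<longleftrightarrow> sqrt (r\<^sup>2 - (norm a)\<^sup>2) < norm y" for y :: complex
    proof -
      have "r < norm (a, y) \<longleftrightarrow> sqrt (r\<^sup>2) < sqrt ((norm a)\<^sup>2 + (norm y)\<^sup>2)"
        using r by (simp add: norm_Pair)
      also have "\<dots> \<longleftrightarrow> sqrt (r\<^sup>2 - (norm a)\<^sup>2) < sqrt ((norm y)\<^sup>2)"
        unfolding real_sqrt_less_iff by auto
      finally show ?thesis by simp
    qed
    show thesis
      using hi lo by (intro that[of "sqrt (r\<^sup>2 - (norm a)\<^sup>2)" "sqrt (1 - (norm a)\<^sup>2)"])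
        (auto simp: pair_shell_def)
  qed
qed

text \<open>Every \<open>m\<close> strictly between \<open>max (max 0 r) (norm a)\<close> and 1 is
  the norm of a pair with first coordinate \<open>a\<close>. This is what lets the extension reach
  the whole unit disc.\<close>

lemma pair_shell_slice_nonempty:
  assumes "norm (a::complex) < 1" "r < 1"
  obtains c where "(a, c) \<in> pair_shell r"
proof -
  obtain m where m: "max (max 0 r) (norm a) < m" "m < 1"
    using dense[of "max (max 0 r) (norm a)" 1] assms by auto
  have "(norm a)\<^sup>2 \<le> m\<^sup>2" using m by (intro power_mono) auto
  then have "norm (a, complex_of_real (sqrt (m\<^sup>2 - (norm a)\<^sup>2))) = m"
    using m by (simp add: norm_Pair)
  with m show thesis
    by (intro that[of "complex_of_real (sqrt (m\<^sup>2 - (norm a)\<^sup>2))"]) (auto simp: pair_shell_def)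
qed

text \<open>By \<open>circle_average_constant\<close> the mean does not depend on the point
  \<open>y\<close> of the slice over \<open>x\<close>. The slices over all |x| < 1 are nonempty, so
  the mean defines \<open>G\<close> on the whole disc, also where \<open>(x, 0)\<close> lies in the
  hole.\<close>

lemma hartogs_average:
  assumes f: "pair_holomorphic f (pair_shell r)" and r: "r < 1"
  obtains G where "G holomorphic_on ball 0 1"
    "\<And>x y. (x, y) \<in> pair_shell r \<Longrightarrow> integral {0..1} (\<lambda>t. f (x, y * circ t)) = G x"
proof -
  define c where "c x = (SOME y. (x, y) \<in> pair_shell r)" for x :: complex
  have c: "(x, c x) \<in> pair_shell r" if "norm x < 1" for x
    using pair_shell_slice_nonempty[OF that r] unfolding c_def by (metis someI)
  define G where "G x = integral {0..1} (\<lambda>t. f (x, c x * circ t))" for x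
  have small: "norm x < 1" if "(x, y) \<in> pair_shell r" for x y :: complex
    using that norm_fst_le[of x y] by (simp add: pair_shell_def)
  have G: "integral {0..1} (\<lambda>t. f (x, y * circ t)) = G x" if xy: "(x, y) \<in> pair_shell r" for x y
    unfolding G_def
  proof (rule circle_average_constant)
    let ?U = "{y. (x, y) \<in> pair_shell r}"
    obtain lo hi where U: "?U = {y. lo < norm y \<and> norm y < hi}"
      using pair_shell_slice small[OF xy] by metis
    show "connected ?U"
      using connected_annulus(1)[where a="0::complex" and ?r1.0=lo and ?r2.0=hi] unfolding U by simp
    show "open ?U"
      unfolding U by (intro open_Collect_conj open_Collect_less continuous_intros)
    show "(\<lambda>y. f (x, y)) holomorphic_on ?U"
      using f by (rule pair_holomorphic_snd) auto
  qed (use xy c[OF small[OF xy]] in auto)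
  have "G field_differentiable at a" if a: "norm a < 1" for a
  proof -
    \<comment> \<open>Nothing is known about how the chosen \<open>c x\<close> varies with
      \<open>x\<close>; as the shell is open, the single value \<open>c a\<close> serves for all
      \<open>x\<close> near \<open>a\<close>.\<close>
    let ?S = "(\<lambda>x. (x, c a)) -` pair_shell r"
    have "open ?S"
      by (intro open_vimage open_pair_shell continuous_intros)
    moreover have "a \<in> ?S" using c a by simp
    ultimately obtain \<delta> where \<delta>: "0 < \<delta>" "cball a \<delta> \<subseteq> ?S"
      using open_contains_cball by blast
    have "(\<lambda>x. integral {0..1} (\<lambda>t. f (x, c a * circ t))) holomorphic_on ball a \<delta>"
    proof (rule holomorphic_parametric_integral)
      show "continuous_on (cball a \<delta> \<times> {0..1}) (\<lambda>(x, t). f (x, c a * circ t))"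
        unfolding case_prod_beta
        by (rule continuous_on_compose2[OF pair_holomorphic_continuous_on[OF f]])
          (use \<delta> in \<open>auto intro!: continuous_intros\<close>)
      show "(\<lambda>x. f (x, c a * circ t)) holomorphic_on ball a \<delta>" for t
        using f by (rule pair_holomorphic_fst) (use \<delta> in \<open>auto simp: subset_iff\<close>)
    qed (use \<delta> in auto)
    also have "?this \<longleftrightarrow> G holomorphic_on ball a \<delta>"
      using \<delta> by (intro holomorphic_cong refl G) (auto simp: subset_iff)
    finally show ?thesis
      using \<delta> by (auto intro: holomorphic_on_imp_differentiable_at)
  qed
  then have "G holomorphic_on ball 0 1"
    by (simp add: holomorphic_on_def field_differentiable_at_within)
  with G that show thesis by blast
qed

lemma set_integral_Icc_eq_integral:
  fixes g :: "real \<Rightarrow> complex"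
  assumes "continuous_on {a..b} g"
  shows "(LINT t:{a..b}|lborel. g t) = integral {a..b} g"
  using set_borel_integral_eq_integral(2)[OF borel_integrable_atLeastAtMost'[OF assms]] .

text \<open>The numbers \<open>g k\<close> are the Taylor coefficients at 0 of the extension from
  \<open>hartogs_average\<close>; the real factor is the moment of the shell.\<close>

lemma shell_moment_holomorphic:
  assumes f: "pair_holomorphic f (pair_shell r)" and r: "r < 1"
    and int: "set_integrable lborel (pair_shell r) f"
  obtains g where
    "\<And>k. (LINT z:pair_shell r|lborel. f z * cnj (fst z) ^ k)
        = g k * of_real (pi\<^sup>2 * (1 - max 0 r ^ (2 * k + 4)) / ((k + 1) * (k + 2)))"
    "\<And>x. (x, 0) \<in> pair_shell r \<Longrightarrow> (\<lambda>k. g k * x ^ k) sums f (x, 0)"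
proof -
  let ?D = "pair_shell r"
  obtain G where G: "G holomorphic_on ball 0 1"
    and avg: "\<And>x y. (x, y) \<in> ?D \<Longrightarrow> integral {0..1} (\<lambda>t. f (x, y * circ t)) = G x"
    using hartogs_average[OF f r] by blast
  have small: "norm x < 1" if "(x, y) \<in> ?D" for x y :: complex
    using that norm_fst_le[of x y] by (simp add: pair_shell_def)
  define g where "g k = (deriv ^^ k) G 0 / fact k" for k
  have contf: "continuous_on ?D f" using f by (rule pair_holomorphic_continuous_on)
  have contG: "continuous_on (ball 0 1) G" using G by (rule holomorphic_on_imp_continuous_on)
  have sums: "(\<lambda>k. g k * x ^ k) sums f (x, 0)" if "(x, 0) \<in> ?D" for x
  proof -
    \<comment> \<open>Rotations fix the second coordinate 0, so the mean is the value of
      \<open>f\<close> itself.\<close>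
    have "G x = f (x, 0)" using avg[OF that] by simp
    with holomorphic_power_series[OF G, of x] small[OF that] show ?thesis
      by (simp add: g_def)
  qed
  have mom: "(LINT z:?D|lborel. f z * cnj (fst z) ^ k)
      = g k * of_real (pi\<^sup>2 * (1 - max 0 r ^ (2 * k + 4)) / ((k + 1) * (k + 2)))" for k
  proof -
    \<comment> \<open>\<open>F1\<close> is the average of \<open>F0\<close> over rotations of the
      second coordinate, and \<open>F2\<close> that of \<open>F1\<close> over rotations of the
      first; hence all three have the same integral.\<close>
    define F0 where "F0 z = indicator ?D z *\<^sub>R (f z * cnj (fst z) ^ k)" for z
    define F1 where "F1 z = indicator ?D z *\<^sub>R (G (fst z) * cnj (fst z) ^ k)" for z
    define F2 where "F2 z = g k * of_real (indicator ?D z * norm (fst z) ^ (2 * k))" for z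
    have rot: "norm (circ t) = 1" for t by simp
    have meas: "(\<lambda>(t, z). (fst z, circ t * snd z)) \<in> borel_measurable (borel :: (real \<times> complex \<times> complex) measure)"
      "(\<lambda>(t, z). (circ t * fst z, snd z)) \<in> borel_measurable (borel :: (real \<times> complex \<times> complex) measure)"
      unfolding case_prod_beta by (intro borel_measurable_continuous_onI continuous_intros)+
    have T1: "lborel_preserving (\<lambda>z :: complex \<times> complex. (fst z, circ t * snd z))" for t
      using lborel_preserving_snd[OF lborel_preserving_rotation[OF rot[of t]]] by (simp add: case_prod_beta')
    have T2: "lborel_preserving (\<lambda>z :: complex \<times> complex. (circ t * fst z, snd z))" for t
      using lborel_preserving_fst[OF lborel_preserving_rotation[OF rot[of t]]] by (simp add: case_prod_beta')
    have I0: "integrable lborel F0"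
    proof (rule Bochner_Integration.integrable_bound)
      show "integrable lborel (\<lambda>z. indicator ?D z *\<^sub>R f z)"
        using int by (simp add: set_integrable_def)
      show "F0 \<in> borel_measurable lborel"
        unfolding F0_def measurable_lborel1 measurable_lborel2
        by (intro borel_measurable_continuous_on_indicator borel_open open_pair_shell continuous_intros contf)
      have "norm (F0 z) \<le> norm (indicator ?D z *\<^sub>R f z)" for z
      proof (cases "z \<in> ?D")
        case True
        then have "norm (fst z) \<le> 1" using small[of "fst z" "snd z"] by simp
        then have "norm (fst z) ^ k \<le> 1" by (intro power_le_one) auto
        then show ?thesis using True by (simp add: F0_def norm_mult norm_power mult_left_le)
      qed (simp add: F0_def)
      then show "AE z in lborel. norm (F0 z) \<le> norm (indicator ?D z *\<^sub>R f z)" by simp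
    qed
    have eq1: "(LINT t:{0..1}|lborel. F0 (fst z, circ t * snd z)) = F1 z" for z
    proof (cases "z \<in> ?D")
      case True
      then have z: "(fst z, snd z) \<in> ?D" by simp
      have c: "continuous_on {0..1} (\<lambda>t. f (fst z, snd z * circ t))"
        by (rule continuous_on_compose2[OF contf]) (use z in \<open>auto intro!: continuous_intros\<close>)
      have "(LINT t:{0..1}|lborel. F0 (fst z, circ t * snd z))
         = (LINT t:{0..1}|lborel. f (fst z, snd z * circ t) * cnj (fst z) ^ k)"
        using z by (simp add: F0_def mult.commute[of "circ _"])
      also have "\<dots> = integral {0..1} (\<lambda>t. f (fst z, snd z * circ t) * cnj (fst z) ^ k)"
        by (intro set_integral_Icc_eq_integral continuous_intros c)
      also have "\<dots> = F1 z" using avg[OF z] True by (simp add: F1_def)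
      finally show ?thesis .
    next
      case False
      then have "(fst z, snd z) \<notin> ?D" by simp
      then show ?thesis using False by (simp add: F0_def F1_def mult.commute[of "circ _"] set_lebesgue_integral_def)
    qed
    have eq2: "(LINT t:{0..1}|lborel. F1 (circ t * fst z, snd z)) = F2 z" for z
    proof (cases "z \<in> ?D")
      case True
      then have z: "(fst z, snd z) \<in> ?D" by simp
      have sm: "norm (fst z) < 1" using small[OF z] .
      have c: "continuous_on {0..1} (\<lambda>t. G (fst z * circ t))"
        by (rule continuous_on_compose2[OF contG]) (use sm in \<open>auto intro!: continuous_intros simp: norm_mult\<close>)
      \<comment> \<open>On the unit circle conjugation is inversion, which produces the division by
        \<open>circ t ^ k\<close> in \<open>holomorphic_circle_coefficient\<close>.\<close>
      have e: "G (fst z * circ t) * cnj (fst z * circ t) ^ k = G (fst z * circ t) / circ t ^ k * cnj (fst z) ^ k" for t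
        by (simp add: power_mult_distrib cis_cnj flip: cis_inverse)
           (simp add: field_simps)
      have "(LINT t:{0..1}|lborel. F1 (circ t * fst z, snd z))
         = (LINT t:{0..1}|lborel. G (fst z * circ t) / circ t ^ k * cnj (fst z) ^ k)"
        using z by (simp only: F1_def mult.commute[of "circ _"] fst_conv e pair_shell_rotate) simp
      also have "\<dots> = integral {0..1} (\<lambda>t. G (fst z * circ t) / circ t ^ k * cnj (fst z) ^ k)"
        by (intro set_integral_Icc_eq_integral continuous_intros c) auto
      also have "\<dots> = g k * fst z ^ k * cnj (fst z) ^ k"
        using has_integral_mult_left[OF holomorphic_circle_coefficient[OF G sm, of k]]
        unfolding g_def by (rule integral_unique)
      also have "\<dots> = F2 z"
      proof -
        have "complex_of_real (norm (fst z) ^ (2 * k)) = complex_of_real ((norm (fst z))\<^sup>2) ^ k"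
          by (simp add: power_mult)
        then have "complex_of_real (norm (fst z) ^ (2 * k)) = fst z ^ k * cnj (fst z) ^ k"
          unfolding complex_norm_square power_mult_distrib .
        with True show ?thesis by (simp add: F2_def)
      qed
      finally show ?thesis .
    next
      case False
      then have "(fst z, snd z) \<notin> ?D" by simp
      then show ?thesis using False by (simp add: F2_def F1_def mult.commute[of "circ _"] set_lebesgue_integral_def)
    qed
    have I1: "integrable lborel F1" and E1: "(\<integral>z. F1 z \<partial>lborel) = (\<integral>z. F0 z \<partial>lborel)"
      using integral_average[OF I0 T1 meas(1)] unfolding eq1 by auto
    have E2: "(\<integral>z. F2 z \<partial>lborel) = (\<integral>z. F1 z \<partial>lborel)"
      using integral_average(2)[OF I1 T2 meas(2)] unfolding eq2 by auto
    have "(LINT z:?D|lborel. f z * cnj (fst z) ^ k) = (\<integral>z. F2 z \<partial>lborel)"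
      using E1 E2 by (simp add: set_lebesgue_integral_def F0_def)
    also have "\<dots> = g k * of_real (\<integral>z. indicator ?D z * norm (fst z) ^ (2 * k) \<partial>lborel)"
      unfolding F2_def integral_mult_right_zero integral_complex_of_real ..
    also have "(\<integral>z. indicator ?D z * norm (fst z) ^ (2 * k) \<partial>lborel)
        = pi\<^sup>2 * (1 - max 0 r ^ (2 * k + 4)) / ((k + 1) * (k + 2))"
      using has_bochner_integral_shell_moment[OF r, of k] by (rule has_bochner_integral_integral_eq)
    finally show ?thesis .
  qed
  from mom sums that show thesis by blast
qed

section \<open>The Bergman kernel of the shell\<close>

text \<open>The reciprocal of the squared L2 norm on the shell of the k-th power of the first
  coordinate, computed in \<open>has_bochner_integral_shell_moment\<close>.\<close>

definition shell_coeff :: "real \<Rightarrow> nat \<Rightarrow> real"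
  where "shell_coeff r k = (k + 1) * (k + 2) / (pi\<^sup>2 * (1 - max 0 r ^ (2 * k + 4)))"

definition shell_series :: "real \<Rightarrow> complex \<Rightarrow> complex"
  where "shell_series r x = (\<Sum>k. of_real (shell_coeff r k) * x ^ k)"

text \<open>The geometric series differentiated twice term by term.\<close>

lemma summable_quadratic_power:
  fixes x :: real
  assumes "norm x < 1"
  shows "summable (\<lambda>k. real (k + 1) * real (k + 2) * x ^ k)"
proof -
  have 1: "summable (\<lambda>n. diffs (\<lambda>_. 1) n * y ^ n)" if "norm y < 1" for y :: real
    by (rule termdiff_converges[OF that]) (simp add: summable_geometric)
  have "summable (\<lambda>n. diffs (diffs (\<lambda>_. 1)) n * x ^ n)"
    by (rule termdiff_converges[OF assms]) (rule 1)
  then show ?thesis by (simp add: diffs_def algebra_simps)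
qed

lemma shell_denominator_pos:
  fixes r :: real
  assumes "r < 1"
  shows "0 < 1 - max 0 r ^ (2 * k + 4)"
proof -
  have "max 0 r ^ (2 * k + 4) \<le> max 0 r ^ 1"
    using assms by (intro power_decreasing) auto
  also have "\<dots> < 1" using assms by simp
  finally show ?thesis by simp
qed

lemma shell_coeff_pos: "r < 1 \<Longrightarrow> 0 < shell_coeff r k"
  unfolding shell_coeff_def using shell_denominator_pos[of r k]
  by (intro divide_pos_pos mult_pos_pos) auto

text \<open>The denominator is smallest at k = 0, so the coefficients grow at most
  quadratically.\<close>

lemma shell_coeff_le:
  assumes "r < 1"
  shows "shell_coeff r k \<le> real (k + 1) * real (k + 2) * (1 / (pi\<^sup>2 * (1 - max 0 r ^ 4)))"
proof -
  have "max 0 r ^ (2 * k + 4) \<le> max 0 r ^ 4"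
    using assms by (intro power_decreasing) auto
  moreover have "0 < 1 - max 0 r ^ 4"
    using shell_denominator_pos[OF assms, of 0] by simp
  ultimately have "1 / (pi\<^sup>2 * (1 - max 0 r ^ (2 * k + 4))) \<le> 1 / (pi\<^sup>2 * (1 - max 0 r ^ 4))"
    by (intro divide_left_mono mult_left_mono mult_pos_pos shell_denominator_pos assms) auto
  from mult_left_mono[OF this, of "real (k + 1) * real (k + 2)"] show ?thesis
    by (simp add: shell_coeff_def add.commute)
qed

lemma summable_shell_coeff:
  assumes "r < 1" "0 \<le> x" "x < 1"
  shows "summable (\<lambda>k. shell_coeff r k * x ^ k)"
proof (rule summable_comparison_test')
  show "summable (\<lambda>k. 1 / (pi\<^sup>2 * (1 - max 0 r ^ 4)) * (real (k + 1) * real (k + 2) * x ^ k))"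
    using assms by (intro summable_mult summable_quadratic_power) auto
  show "norm (shell_coeff r k * x ^ k) \<le> 1 / (pi\<^sup>2 * (1 - max 0 r ^ 4)) * (real (k + 1) * real (k + 2) * x ^ k)" for k
    using mult_right_mono[OF shell_coeff_le[OF assms(1), of k], of "x ^ k"] assms(2)
      shell_coeff_pos[OF assms(1), of k]
    by (simp add: abs_mult mult_ac)
qed

lemma shell_series_sums:
  assumes "r < 1" "norm x < 1"
  shows "(\<lambda>k. of_real (shell_coeff r k) * x ^ k) sums shell_series r x"
proof -
  have "summable (\<lambda>k. norm (complex_of_real (shell_coeff r k) * x ^ k))"
    using summable_shell_coeff[of r "norm x"] assms shell_coeff_pos[OF assms(1)]
    by (simp add: norm_mult norm_power less_imp_le)
  then show ?thesis
    unfolding shell_series_def by (rule summable_sums[OF summable_norm_cancel])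
qed

lemma shell_series_holomorphic:
  assumes "r < 1"
  shows "shell_series r holomorphic_on ball 0 1"
  by (rule power_series_holomorphic[where a="\<lambda>k. of_real (shell_coeff r k)"])
    (use shell_series_sums[OF assms] in auto)

text \<open>The kernel is expanded into powers. The k-th term integrates to a moment of
  \<open>f\<close>, in which \<open>shell_coeff r k\<close> cancels the moment of the shell and
  leaves \<open>g k * s ^ k\<close>; these sum to \<open>f (s, 0)\<close>.\<close>

lemma shell_series_reproduces_on_axis:
  assumes r: "r < 1" and f: "pair_holomorphic f (pair_shell r)"
    and int: "set_integrable lborel (pair_shell r) f" and s: "(s, 0) \<in> pair_shell r"
  shows "(LINT z:pair_shell r|lborel. f z * cnj (shell_series r (fst z * cnj s))) = f (s, 0)"
proof -
  let ?D = "pair_shell r"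
  obtain g where mom: "\<And>k. (LINT z:?D|lborel. f z * cnj (fst z) ^ k)
        = g k * of_real (pi\<^sup>2 * (1 - max 0 r ^ (2 * k + 4)) / ((k + 1) * (k + 2)))"
    and sums: "\<And>x. (x, 0) \<in> ?D \<Longrightarrow> (\<lambda>k. g k * x ^ k) sums f (x, 0)"
    using shell_moment_holomorphic[OF f r int] by blast
  have s1: "norm s < 1" using s by (simp add: pair_shell_def)
  have small: "norm (fst z) \<le> 1" if "z \<in> ?D" for z
    using that norm_fst_le[of "fst z" "snd z"] by (simp add: pair_shell_def)
  define u where "u k z = of_real (shell_coeff r k) * s ^ k * (indicator ?D z *\<^sub>R (f z * cnj (fst z) ^ k))"
    for k z
  have contf: "continuous_on ?D f" using f by (rule pair_holomorphic_continuous_on)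
  have intf: "integrable lborel (\<lambda>z. indicator ?D z *\<^sub>R f z)"
    using int by (simp add: set_integrable_def)
  have bound: "norm (indicator ?D z *\<^sub>R (f z * cnj (fst z) ^ k)) \<le> norm (indicator ?D z *\<^sub>R f z)" for z k
  proof (cases "z \<in> ?D")
    case True
    then have "norm (fst z) ^ k \<le> 1" using small by (intro power_le_one) auto
    then show ?thesis using True by (simp add: norm_mult norm_power mult_left_le)
  qed simp
  have intk: "integrable lborel (\<lambda>z. indicator ?D z *\<^sub>R (f z * cnj (fst z) ^ k))" for k
  proof (rule Bochner_Integration.integrable_bound[OF intf])
    show "(\<lambda>z. indicator ?D z *\<^sub>R (f z * cnj (fst z) ^ k)) \<in> borel_measurable lborel"
      unfolding measurable_lborel1 measurable_lborel2
      by (intro borel_measurable_continuous_on_indicator borel_open open_pair_shell continuous_intros contf)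
  qed (use bound in simp)
  \<comment> \<open>On the shell |fst z| <= 1, so the k-th term is at most
    \<open>?c k * norm (f z)\<close>, and \<open>?c\<close> is summable because |s| < 1. This
    justifies exchanging sum and integral.\<close>
  let ?c = "\<lambda>k. shell_coeff r k * norm s ^ k"
  have normu: "norm (u k z) \<le> ?c k * norm (indicator ?D z *\<^sub>R f z)" for k z
    unfolding u_def using bound[of z k] shell_coeff_pos[OF r, of k]
    by (simp only: norm_mult norm_power norm_of_real) (intro mult_mono; simp)
  have csum: "summable ?c" using r s1 by (intro summable_shell_coeff) auto
  have U: "(\<lambda>k. \<integral>z. u k z \<partial>lborel) sums (\<integral>z. (\<Sum>k. u k z) \<partial>lborel)"
  proof (rule sums_integral)
    show uint: "integrable lborel (u k)" for k
      unfolding u_def by (intro integrable_mult_right intk)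
    show "AE z in lborel. summable (\<lambda>k. norm (u k z))"
      using normu by (intro AE_I2 summable_comparison_test'[OF summable_mult2[OF csum]]) auto
    show "summable (\<lambda>k. \<integral>z. norm (u k z) \<partial>lborel)"
    proof (rule summable_comparison_test'[OF summable_mult2[OF csum]])
      fix k
      have "(\<integral>z. norm (u k z) \<partial>lborel) \<le> (\<integral>z. ?c k * norm (indicator ?D z *\<^sub>R f z) \<partial>lborel)"
        using normu uint intf by (intro integral_mono integrable_norm integrable_mult_right) auto
      then show "norm (\<integral>z. norm (u k z) \<partial>lborel) \<le> ?c k * (\<integral>z. norm (indicator ?D z *\<^sub>R f z) \<partial>lborel)"
        by simp
    qed
  qed
  have "(\<integral>z. u k z \<partial>lborel) = g k * s ^ k" for k
  proof -
    have "(\<integral>z. u k z \<partial>lborel) = of_real (shell_coeff r k) * s ^ k * (LINT z:?D|lborel. f z * cnj (fst z) ^ k)"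
      unfolding u_def set_lebesgue_integral_def by (rule integral_mult_right_zero)
    also have "\<dots> = g k * s ^ k *
        of_real (shell_coeff r k * (pi\<^sup>2 * (1 - max 0 r ^ (2 * k + 4)) / ((k + 1) * (k + 2))))"
      unfolding mom by simp
    also have "shell_coeff r k * (pi\<^sup>2 * (1 - max 0 r ^ (2 * k + 4)) / ((k + 1) * (k + 2))) = 1"
    proof -
      have *: "A / B * (B / A) = 1" if "A \<noteq> 0" "B \<noteq> 0" for A B :: real
        using that by simp
      have A: "(real k + 1) * (real k + 2) = real ((k + 1) * (k + 2))"
        by (simp only: of_nat_mult of_nat_add of_nat_1 of_nat_numeral)
      have "real ((k + 1) * (k + 2)) \<noteq> 0" by (simp only: of_nat_eq_0_iff) simp
      moreover have "pi\<^sup>2 * (1 - max 0 r ^ (2 * k + 4)) \<noteq> 0"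
        using shell_denominator_pos[OF r, of k] by simp
      ultimately show ?thesis
        unfolding shell_coeff_def A by (rule *)
    qed
    finally show ?thesis by simp
  qed
  then have "(\<integral>z. (\<Sum>k. u k z) \<partial>lborel) = f (s, 0)"
    using U sums[OF s] sums_unique2 by simp
  moreover have "(\<Sum>k. u k z) = indicator ?D z *\<^sub>R (f z * cnj (shell_series r (fst z * cnj s)))" for z
  proof (cases "z \<in> ?D")
    case True
    have "norm (fst z) * norm s \<le> 1 * norm s" using small[OF True] by (intro mult_right_mono) auto
    then have "norm (fst z * cnj s) < 1" using s1 by (simp add: norm_mult)
    from sums_mult[OF sums_cnj[THEN iffD2, OF shell_series_sums[OF r this]], of "f z"]
    have "(\<lambda>k. u k z) sums (f z * cnj (shell_series r (fst z * cnj s)))"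
      using True by (simp add: u_def power_mult_distrib mult_ac)
    then show ?thesis using True by (simp add: sums_unique[symmetric])
  qed (simp add: u_def)
  ultimately show ?thesis
    by (simp add: set_lebesgue_integral_def)
qed

section \<open>Reproduction at an arbitrary point by unitary invariance\<close>

text \<open>The real Cauchy-Schwarz inequality applied to the pairs of moduli.\<close>

lemma norm_pair_inner_le:
  fixes z w :: "complex \<times> complex"
  shows "norm (fst z * cnj (fst w) + snd z * cnj (snd w)) \<le> norm z * norm w"
proof -
  have "norm (fst z * cnj (fst w) + snd z * cnj (snd w))
      \<le> norm (fst z) * norm (fst w) + norm (snd z) * norm (snd w)"
    by (rule order_trans[OF norm_triangle_ineq]) (simp add: norm_mult)
  also have "\<dots> = (norm (fst z), norm (snd z)) \<bullet> (norm (fst w), norm (snd w))"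
    by simp
  also have "\<dots> \<le> norm (norm (fst z), norm (snd z)) * norm (norm (fst w), norm (snd w))"
    by (rule norm_cauchy_schwarz)
  also have "\<dots> = norm z * norm w"
    by (simp add: norm_prod_def)
  finally show ?thesis .
qed

lemma pair_shell_inner:
  assumes "z \<in> pair_shell r" "w \<in> pair_shell r"
  shows "norm (fst z * cnj (fst w) + snd z * cnj (snd w)) < 1"
proof -
  have "norm z * norm w \<le> 1 * norm w"
    using assms by (intro mult_right_mono) (auto simp: pair_shell_def)
  with assms norm_pair_inner_le[of z w] show ?thesis by (simp add: pair_shell_def)
qed

text \<open>A matrix \<open>U\<close> in SU(2) carries an axis point \<open>(s, 0)\<close> to
  \<open>w\<close>. It preserves Lebesgue measure, the shell and the Hermitian product, so the axis
  case for \<open>\<lambda>z. f (U z)\<close> gives the claim.\<close>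

lemma shell_series_reproduces:
  assumes r: "r < 1" and f: "pair_holomorphic f (pair_shell r)"
    and int: "set_integrable lborel (pair_shell r) f" and w: "w \<in> pair_shell r"
  shows "(LINT z:pair_shell r|lborel.
     f z * cnj (shell_series r (fst z * cnj (fst w) + snd z * cnj (snd w)))) = f w"
proof -
  let ?D = "pair_shell r"
  define s where "s = complex_of_real (norm w)"
  \<comment> \<open>\<open>(\<alpha>, \<beta>)\<close> is the unit vector in the direction of
    \<open>w\<close>. The point \<open>w = 0\<close> occurs only in the ball, and any unit vector
    serves there.\<close>
  obtain \<alpha> \<beta> where ab: "\<alpha> * cnj \<alpha> + \<beta> * cnj \<beta> = 1" and w_eq: "\<alpha> * s = fst w" "\<beta> * s = snd w"
  proof (cases "w = 0")
    case True
    then show thesis by (intro that[of 1 0]) (auto simp: s_def)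
  next
    case False
    have "complex_of_real ((norm (fst w))\<^sup>2 + (norm (snd w))\<^sup>2) = complex_of_real ((norm w)\<^sup>2)"
      by (simp add: norm_prod_def)
    then have "fst w * cnj (fst w) + snd w * cnj (snd w) = s * s"
      unfolding of_real_add complex_norm_square[of "fst w"] complex_norm_square[of "snd w"]
      by (simp add: s_def power2_eq_square)
    then show thesis
      using False by (intro that[of "fst w / s" "snd w / s"]) (auto simp: s_def add_divide_distrib[symmetric])
  qed
  \<comment> \<open>The first column is \<open>(\<alpha>, \<beta>)\<close>; the second makes the
    matrix unitary with determinant 1, as \<open>lborel_preserving_SL2\<close> requires.\<close>
  define U where "U z = (\<alpha> * fst z + - cnj \<beta> * snd z, \<beta> * fst z + cnj \<alpha> * snd z)" for z :: "complex \<times> complex"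
  have U: "lborel_preserving U"
  proof -
    have "\<alpha> * cnj \<alpha> - - cnj \<beta> * \<beta> = 1" using ab by (simp add: mult.commute)
    from lborel_preserving_SL2[OF this] show ?thesis unfolding U_def by (simp add: case_prod_beta')
  qed
  have inner_U: "fst (U z) * cnj (fst (U z')) + snd (U z) * cnj (snd (U z'))
      = fst z * cnj (fst z') + snd z * cnj (snd z')" for z z'
  proof -
    have "fst (U z) * cnj (fst (U z')) + snd (U z) * cnj (snd (U z'))
      = (\<alpha> * cnj \<alpha> + \<beta> * cnj \<beta>) * (fst z * cnj (fst z') + snd z * cnj (snd z'))"
      by (simp add: U_def algebra_simps)
    with ab show ?thesis by simp
  qed
  have norm_sq: "complex_of_real ((norm z)\<^sup>2) = fst z * cnj (fst z) + snd z * cnj (snd z)" for z :: "complex \<times> complex"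
    unfolding complex_norm_square[symmetric] of_real_add[symmetric] by (simp add: norm_prod_def)
  have norm_U: "norm (U z) = norm z" for z
  proof -
    have "complex_of_real ((norm (U z))\<^sup>2) = complex_of_real ((norm z)\<^sup>2)"
      unfolding norm_sq inner_U ..
    then have "(norm (U z))\<^sup>2 = (norm z)\<^sup>2" by (simp only: of_real_eq_iff)
    then show ?thesis by (rule power2_eq_imp_eq) auto
  qed
  have UD: "U z \<in> ?D \<longleftrightarrow> z \<in> ?D" for z by (simp add: pair_shell_def norm_U)
  have Us: "U (s, 0) = w" using w_eq by (simp add: U_def prod_eq_iff)
  have sD: "(s, 0) \<in> ?D" using w UD[of "(s, 0)"] Us by simp
  have contf: "continuous_on ?D f" using f by (rule pair_holomorphic_continuous_on)
  have fU: "pair_holomorphic (\<lambda>z. f (U z)) ?D"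
    unfolding pair_holomorphic_def
  proof
    fix z assume "z \<in> ?D"
    then obtain A B where d: "(f has_derivative (\<lambda>h. A * fst h + B * snd h)) (at (U z))"
      using f UD unfolding pair_holomorphic_def by blast
    have "(U has_derivative U) (at z)"
      unfolding U_def by (auto intro!: derivative_eq_intros)
    from has_derivative_compose[OF this, of f "\<lambda>h. A * fst h + B * snd h"] d
    have "((\<lambda>z. f (U z)) has_derivative (\<lambda>h. A * fst (U h) + B * snd (U h))) (at z)" by simp
    also have "(\<lambda>h. A * fst (U h) + B * snd (U h))
       = (\<lambda>h. (A * \<alpha> + B * \<beta>) * fst h + (- A * cnj \<beta> + B * cnj \<alpha>) * snd h)"
      by (simp add: U_def algebra_simps)
    finally show "\<exists>A B. ((\<lambda>z. f (U z)) has_derivative (\<lambda>h. A * fst h + B * snd h)) (at z)" by blast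
  qed
  have fUint: "set_integrable lborel ?D (\<lambda>z. f (U z))"
  proof -
    have "integrable (distr lborel lborel U) (\<lambda>z. indicator ?D z *\<^sub>R f z)"
      using int U by (simp add: set_integrable_def lborel_preserving_def)
    moreover have "(\<lambda>z. indicator ?D z *\<^sub>R f z) \<in> borel_measurable borel"
      by (intro borel_measurable_continuous_on_indicator borel_open open_pair_shell contf)
    ultimately have "integrable lborel (\<lambda>z. indicator ?D (U z) *\<^sub>R f (U z))"
      using U by (subst (asm) integrable_distr_eq) (auto simp: lborel_preserving_def)
    then show ?thesis
      by (simp add: set_integrable_def UD indicator_def)
  qed
  let ?H = "\<lambda>z. indicator ?D z *\<^sub>R (f z * cnj (shell_series r (fst z * cnj (fst w) + snd z * cnj (snd w))))"
  have Hmeas: "?H \<in> borel_measurable borel"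
    by (intro borel_measurable_continuous_on_indicator borel_open open_pair_shell continuous_intros contf
        continuous_on_compose2[OF holomorphic_on_imp_continuous_on[OF shell_series_holomorphic[OF r]]])
      (use pair_shell_inner w in auto)
  have "(\<integral>z. ?H z \<partial>lborel) = (\<integral>z. ?H (U z) \<partial>lborel)"
    by (rule lborel_preserving_integral[OF U Hmeas, symmetric])
  also have "\<dots> = (LINT z:?D|lborel. f (U z) * cnj (shell_series r (fst z * cnj s)))"
    using inner_U[of _ "(s, 0)"] UD by (simp add: Us set_lebesgue_integral_def indicator_def)
  also have "\<dots> = f (U (s, 0))"
    by (rule shell_series_reproduces_on_axis[OF r fU fUint sD])
  finally show ?thesis by (simp add: Us set_lebesgue_integral_def)
qed

section \<open>Transfer from pairs to vectors\<close>

definition vec2 :: "complex \<times> complex \<Rightarrow> complex ^ 2"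
  where "vec2 z = vector [fst z, snd z]"

lemma vec2_nth [simp]: "vec2 z $ 1 = fst z" "vec2 z $ 2 = snd z"
  by (simp_all add: vec2_def)

lemma vec2_components [simp]: "vec2 (x $ 1, x $ 2) = x"
  by (simp add: vec_eq_iff forall_2)

lemma norm_vec2 [simp]: "norm (vec2 z) = norm z"
  by (simp add: norm_vec_def L2_set_def sum_2 norm_prod_def)

lemma vec2_in_shell [simp]: "vec2 z \<in> shell r \<longleftrightarrow> z \<in> pair_shell r"
  by (simp add: shell_def pair_shell_def)

lemma components_in_pair_shell [simp]: "(x $ 1, x $ 2) \<in> pair_shell r \<longleftrightarrow> x \<in> shell r"
  using vec2_in_shell[of "(x $ 1, x $ 2)" r] by (simp del: vec2_in_shell)

lemma bounded_linear_vec2: "bounded_linear vec2"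
  by (rule bounded_linear_intro[where K=1]) (simp_all add: vec_eq_iff forall_2)

lemma vec2_measurable: "vec2 \<in> borel_measurable borel"
  by (intro borel_measurable_continuous_onI linear_continuous_on bounded_linear_vec2)

lemma lborel_distr_vec2: "distr lborel lborel vec2 = lborel"
proof -
  have "vec2 = (\<lambda>(x, y). vector [x, y])" by (auto simp: vec2_def fun_eq_iff)
  from lborel_distr_vector_2[where ?'a=complex, folded this] show ?thesis .
qed

lemma integral_vec2:
  fixes F :: "complex ^ 2 \<Rightarrow> complex"
  assumes "F \<in> borel_measurable borel"
  shows "(\<integral>x. F x \<partial>lborel) = (\<integral>z. F (vec2 z) \<partial>lborel)"
proof -
  have "(\<integral>x. F x \<partial>distr lborel lborel vec2) = (\<integral>z. F (vec2 z) \<partial>lborel)"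
    using assms vec2_measurable by (intro integral_distr) auto
  then show ?thesis by (simp only: lborel_distr_vec2)
qed

lemma integrable_vec2:
  fixes F :: "complex ^ 2 \<Rightarrow> 'b::{banach,second_countable_topology}"
  assumes "F \<in> borel_measurable borel"
  shows "integrable lborel F \<longleftrightarrow> integrable lborel (\<lambda>z. F (vec2 z))"
proof -
  have "integrable (distr lborel lborel vec2) F \<longleftrightarrow> integrable lborel (\<lambda>z. F (vec2 z))"
    using assms vec2_measurable by (intro integrable_distr_eq) auto
  then show ?thesis by (simp only: lborel_distr_vec2)
qed

lemma open_shell: "open (shell r)"
  unfolding shell_def by (intro open_Collect_conj open_Collect_less continuous_intros)

lemma holomorphic_vec_on_continuous_on:
  "holomorphic_vec_on f D \<Longrightarrow> continuous_on D f"
  unfolding holomorphic_vec_on_def continuous_on_eq_continuous_within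
  by (blast intro: has_derivative_continuous)

text \<open>A complex-homogeneous derivative is determined by its values at the two coordinate
  vectors, which become the partial derivatives.\<close>

lemma pair_holomorphic_vec2:
  assumes "holomorphic_vec_on f (shell r)"
  shows "pair_holomorphic (\<lambda>z. f (vec2 z)) (pair_shell r)"
  unfolding pair_holomorphic_def
proof
  fix z assume z: "z \<in> pair_shell r"
  then have z': "vec2 z \<in> shell r" by simp
  then obtain L where "(f has_derivative L) (at (vec2 z) within shell r)"
    and L: "\<And>c v. L (c *s v) = c * L v"
    using assms unfolding holomorphic_vec_on_def by blast
  then have d: "(f has_derivative L) (at (vec2 z))"
    using z' by (simp add: at_within_open[OF _ open_shell])
  have "(vec2 has_derivative vec2) (at z)"
    by (rule bounded_linear.has_derivative[OF bounded_linear_vec2, OF has_derivative_ident])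
  from has_derivative_compose[OF this, of f L] d
  have "((\<lambda>z. f (vec2 z)) has_derivative (\<lambda>h. L (vec2 h))) (at z)" by simp
  moreover have "L (vec2 h) = L (axis 1 1) * fst h + L (axis 2 1) * snd h" for h
  proof -
    interpret L: linear L using d by (rule has_derivative_linear)
    have "vec2 h = fst h *s axis 1 1 + snd h *s axis 2 1"
      by (simp add: vec_eq_iff forall_2 axis_def)
    then show ?thesis by (simp add: L.add L mult.commute)
  qed
  ultimately show "\<exists>A B. ((\<lambda>z. f (vec2 z)) has_derivative (\<lambda>h. A * fst h + B * snd h)) (at z)"
    by auto
qed

definition hdot :: "complex ^ 2 \<Rightarrow> complex ^ 2 \<Rightarrow> complex"
  where "hdot z w = z $ 1 * cnj (w $ 1) + z $ 2 * cnj (w $ 2)"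

lemma norm_hdot_le: "norm (hdot z w) \<le> norm z * norm w"
  using norm_pair_inner_le[of "(z $ 1, z $ 2)" "(w $ 1, w $ 2)"]
    norm_vec2[of "(z $ 1, z $ 2)"] norm_vec2[of "(w $ 1, w $ 2)"]
  by (simp add: hdot_def del: norm_vec2)

lemma norm_hdot_le': "z \<in> shell r \<Longrightarrow> norm (hdot z w) \<le> norm w"
  using norm_hdot_le[of z w] mult_right_mono[of "norm z" 1 "norm w"] by (simp add: shell_def)

lemma hdot_self: "hdot z z = complex_of_real ((norm z)\<^sup>2)"
proof -
  have "(norm z)\<^sup>2 = (norm (z $ 1))\<^sup>2 + (norm (z $ 2))\<^sup>2"
    by (simp add: norm_vec_def L2_set_def sum_2)
  then show ?thesis
    by (simp only: hdot_def of_real_add complex_norm_square)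
qed

text \<open>The value 0 off the shell meets the first conjunct of
  \<open>is_bergman_kernel\<close>.\<close>

definition shell_kernel :: "real \<Rightarrow> complex ^ 2 \<Rightarrow> complex ^ 2 \<Rightarrow> complex"
  where "shell_kernel r z w =
    (if z \<in> shell r \<and> w \<in> shell r then shell_series r (hdot z w) else 0)"

lemma holomorphic_vec_on_shell_kernel:
  assumes r: "r < 1" and w: "w \<in> shell r"
  shows "holomorphic_vec_on (\<lambda>z. shell_kernel r z w) (shell r)"
  unfolding holomorphic_vec_on_def
proof
  fix z assume z: "z \<in> shell r"
  have "norm (hdot z w) < 1"
    using norm_hdot_le'[OF z, of w] w by (simp add: shell_def)
  then have "(shell_series r has_field_derivative deriv (shell_series r) (hdot z w)) (at (hdot z w))"
    by (intro holomorphic_derivI[OF shell_series_holomorphic[OF r]]) auto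
  then have d: "(shell_series r has_derivative (*) (deriv (shell_series r) (hdot z w))) (at (hdot z w))"
    by (simp add: has_field_derivative_def)
  have lin: "linear (\<lambda>v. hdot v w)"
    by (intro linearI) (simp_all add: hdot_def algebra_simps)
  then have "((\<lambda>v. hdot v w) has_derivative (\<lambda>v. hdot v w)) (at z within shell r)"
    by (rule linear_imp_has_derivative)
  from has_derivative_compose[OF this, of "shell_series r"] d
  have "((\<lambda>z. shell_series r (hdot z w)) has_derivative
      (\<lambda>v. deriv (shell_series r) (hdot z w) * hdot v w)) (at z within shell r)" by simp
  then have "((\<lambda>z. shell_kernel r z w) has_derivative
      (\<lambda>v. deriv (shell_series r) (hdot z w) * hdot v w)) (at z within shell r)"
    by (rule has_derivative_transform[OF z, rotated]) (use w in \<open>simp add: shell_kernel_def\<close>)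
  moreover have "hdot (c *s v) w = c * hdot v w" for c v
    by (simp add: hdot_def algebra_simps)
  ultimately show "\<exists>L. ((\<lambda>z. shell_kernel r z w) has_derivative L) (at z within shell r) \<and>
      (\<forall>c v. L (c *s v) = c * L v)"
    by (intro exI[of _ "\<lambda>v. deriv (shell_series r) (hdot z w) * hdot v w"]) simp
qed

lemma emeasure_shell_finite: "emeasure lborel (shell r) < \<infinity>"
proof -
  have "bounded (shell r)"
    by (rule bounded_subset[OF bounded_ball[of 0 1]]) (auto simp: shell_def)
  then show ?thesis by (rule emeasure_bounded_finite)
qed

lemma set_integrable_shell_const: "set_integrable lborel (shell r) (\<lambda>_. c :: real)"
  unfolding set_integrable_def using emeasure_shell_finite[of r] borel_open[OF open_shell[of r]]
  by (intro integrable_scaleR_left integrable_indicator) auto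

text \<open>For fixed \<open>w\<close> the argument \<open>hdot z w\<close> stays in the compact
  disc of radius \<open>norm w < 1\<close>, so the kernel is bounded in \<open>z\<close>, and the
  shell has finite measure.\<close>

lemma shell_kernel_in_L2h:
  assumes r: "r < 1" and w: "w \<in> shell r"
  shows "(\<lambda>z. shell_kernel r z w) \<in> L2h (shell r)"
  unfolding L2h_def
proof (intro CollectI conjI holomorphic_vec_on_shell_kernel[OF r w])
  have nw: "norm w < 1" using w by (simp add: shell_def)
  have "compact (shell_series r ` cball 0 (norm w))"
    using nw by (intro compact_continuous_image holomorphic_on_imp_continuous_on
        holomorphic_on_subset[OF shell_series_holomorphic[OF r]]) auto
  then obtain M where M: "\<And>x. norm x \<le> norm w \<Longrightarrow> norm (shell_series r x) \<le> M"
    using compact_imp_bounded bounded_iff by (metis image_eqI mem_cball_0)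
  show "set_integrable lborel (shell r) (\<lambda>z. (norm (shell_kernel r z w))\<^sup>2)"
    unfolding set_integrable_def
  proof (rule Bochner_Integration.integrable_bound)
    show "integrable lborel (\<lambda>z. indicator (shell r) z *\<^sub>R M\<^sup>2)"
      using set_integrable_shell_const[of r "M\<^sup>2"] by (simp add: set_integrable_def)
    show "(\<lambda>z. indicator (shell r) z *\<^sub>R (norm (shell_kernel r z w))\<^sup>2) \<in> borel_measurable lborel"
      unfolding measurable_lborel1 measurable_lborel2
      by (intro borel_measurable_continuous_on_indicator borel_open open_shell continuous_intros
          holomorphic_vec_on_continuous_on[OF holomorphic_vec_on_shell_kernel[OF r w]])
    have "norm (indicator (shell r) z *\<^sub>R (norm (shell_kernel r z w))\<^sup>2)
        \<le> norm (indicator (shell r) z *\<^sub>R M\<^sup>2)" for z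
      using M[of "hdot z w"] norm_hdot_le'[of z r w] w
      by (auto simp: indicator_def shell_kernel_def intro!: power_mono)
    then show "AE z in lborel. norm (indicator (shell r) z *\<^sub>R (norm (shell_kernel r z w))\<^sup>2)
        \<le> norm (indicator (shell r) z *\<^sub>R M\<^sup>2)" by simp
  qed
qed

text \<open>On a set of finite measure square integrability implies integrability, through |x| <= 1
  + |x|^2.\<close>

lemma L2h_shell_integrable:
  assumes "f \<in> L2h (shell r)"
  shows "set_integrable lborel (shell r) f"
  unfolding set_integrable_def
proof (rule Bochner_Integration.integrable_bound)
  show "integrable lborel (\<lambda>z. indicator (shell r) z *\<^sub>R (1 :: real) + indicator (shell r) z *\<^sub>R (norm (f z))\<^sup>2)"
    using assms set_integrable_shell_const[of r 1]
    by (intro Bochner_Integration.integrable_add) (auto simp: L2h_def set_integrable_def)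
  show "(\<lambda>z. indicator (shell r) z *\<^sub>R f z) \<in> borel_measurable lborel"
    unfolding measurable_lborel1 measurable_lborel2 using assms
    by (intro borel_measurable_continuous_on_indicator borel_open open_shell
        holomorphic_vec_on_continuous_on) (simp add: L2h_def)
  have "norm x \<le> 1 + (norm x)\<^sup>2" for x :: complex
    using zero_le_power2[of "norm x - 1/2"] by (simp add: power2_eq_square algebra_simps)
  then show "AE z in lborel. norm (indicator (shell r) z *\<^sub>R f z)
     \<le> norm (indicator (shell r) z *\<^sub>R (1 :: real) + indicator (shell r) z *\<^sub>R (norm (f z))\<^sup>2)"
    by (intro AE_I2) (auto simp: indicator_def)
qed

text \<open>Pulling the integral back along \<open>vec2\<close> reduces the reproducing property to
  \<open>shell_series_reproduces\<close>.\<close>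

lemma is_bergman_kernel_shell:
  assumes r: "r < 1"
  shows "is_bergman_kernel (shell r) (shell_kernel r)"
  unfolding is_bergman_kernel_def
proof (intro conjI allI impI ballI)
  fix z w assume "z \<notin> shell r \<or> w \<notin> shell r"
  then show "shell_kernel r z w = 0" by (auto simp: shell_kernel_def)
next
  fix w assume w: "w \<in> shell r"
  show "(\<lambda>z. shell_kernel r z w) \<in> L2h (shell r)" by (rule shell_kernel_in_L2h[OF r w])
  fix f assume f: "f \<in> L2h (shell r)"
  then have hol: "holomorphic_vec_on f (shell r)" by (simp add: L2h_def)
  note contf = holomorphic_vec_on_continuous_on[OF hol]
  let ?F = "\<lambda>z. indicator (shell r) z *\<^sub>R (f z * cnj (shell_kernel r z w))"
  have meas: "?F \<in> borel_measurable borel"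
    by (intro borel_measurable_continuous_on_indicator borel_open open_shell continuous_intros contf
        holomorphic_vec_on_continuous_on[OF holomorphic_vec_on_shell_kernel[OF r w]])
  have "(\<lambda>z. indicator (shell r) z *\<^sub>R f z) \<in> borel_measurable borel"
    by (intro borel_measurable_continuous_on_indicator borel_open open_shell contf)
  from integrable_vec2[OF this] L2h_shell_integrable[OF f]
  have int: "set_integrable lborel (pair_shell r) (\<lambda>z. f (vec2 z))"
    by (simp add: set_integrable_def indicator_def)
  let ?w = "(w $ 1, w $ 2)"
  have "(LINT z:shell r|lborel. f z * cnj (shell_kernel r z w)) = (\<integral>z. ?F (vec2 z) \<partial>lborel)"
    unfolding set_lebesgue_integral_def by (rule integral_vec2[OF meas])
  also have "\<dots> = (LINT z:pair_shell r|lborel.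
     f (vec2 z) * cnj (shell_series r (fst z * cnj (fst ?w) + snd z * cnj (snd ?w))))"
    unfolding set_lebesgue_integral_def
    by (intro Bochner_Integration.integral_cong refl)
      (use w in \<open>auto simp: indicator_def shell_kernel_def hdot_def\<close>)
  also have "\<dots> = f (vec2 ?w)"
    using w by (intro shell_series_reproduces[OF r pair_holomorphic_vec2[OF hol] int]) simp
  finally show "f w = (LINT z:shell r|lborel. f z * cnj (shell_kernel r z w))" by simp
qed

lemma bergman_kernel_shell: "r < 1 \<Longrightarrow> bergman_kernel (shell r) = shell_kernel r"
  unfolding bergman_kernel_def
  by (rule the_equality) (auto intro: is_bergman_kernel_shell is_bergman_kernel_unique)

section \<open>The Bergman metric of a radial kernel\<close>

text \<open>The direction \<open>c\<close> is kept general because the Wirtinger derivatives need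
  both \<open>c = 1\<close> and \<open>c = \<i>\<close>. The coefficient of \<open>t\<close> is the
  directional derivative of the squared norm.\<close>

lemma norm_add_axis_square:
  fixes z :: "complex ^ 'n"
  shows "(norm (z + axis j (c * of_real t)))\<^sup>2 = (norm z)\<^sup>2 + t * (2 * (z $ j \<bullet> c)) + t\<^sup>2 * (norm c)\<^sup>2"
proof -
  have "c * of_real t = t *\<^sub>R c" by (simp add: scaleR_conv_of_real mult.commute)
  then have "(norm (z + axis j (c * of_real t)))\<^sup>2
      = (z \<bullet> z) + 2 * t * (z $ j \<bullet> c) + t * (t * (c \<bullet> c))"
    by (simp add: power2_norm_eq_inner inner_add_left inner_add_right inner_axis inner_axis' inner_commute)
  then show ?thesis
    by (simp add: power2_norm_eq_inner[symmetric] power2_eq_square)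
qed

lemma has_vector_derivative_norm_square_along_axis:
  fixes z :: "complex ^ 'n"
  assumes "(g has_real_derivative g') (at ((norm z)\<^sup>2))"
  shows "((\<lambda>t. complex_of_real (g ((norm (z + axis j (c * of_real t)))\<^sup>2)))
     has_vector_derivative of_real (g' * (2 * (z $ j \<bullet> c)))) (at 0)"
proof -
  have "((\<lambda>t. (norm z)\<^sup>2 + t * (2 * (z $ j \<bullet> c)) + t\<^sup>2 * (norm c)\<^sup>2)
      has_real_derivative (2 * (z $ j \<bullet> c))) (at 0)"
    by (auto intro!: derivative_eq_intros)
  then have "((\<lambda>t. g ((norm z)\<^sup>2 + t * (2 * (z $ j \<bullet> c)) + t\<^sup>2 * (norm c)\<^sup>2))
      has_real_derivative g' * (2 * (z $ j \<bullet> c))) (at 0)"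
    by (rule DERIV_chain') (use assms in simp)
  then show ?thesis
    unfolding norm_add_axis_square by (rule has_vector_derivative_of_real)
qed

text \<open>Derivatives are local; the formulas for the kernel and its logarithm are at hand only on
  the open set \<open>D\<close>.\<close>

lemma has_vector_derivative_along_axis_cong:
  fixes z :: "complex ^ 'n"
  assumes D: "open D" "z \<in> D" and eq: "\<And>x. x \<in> D \<Longrightarrow> F x = G x"
    and der: "((\<lambda>t. G (z + axis j (c * of_real t))) has_vector_derivative d) (at (0 :: real))"
  shows "((\<lambda>t. F (z + axis j (c * of_real t))) has_vector_derivative d) (at 0)"
proof -
  let ?S = "(\<lambda>t :: real. z + axis j (c * of_real t)) -` D"
  have "continuous_on UNIV (\<lambda>t :: real. if i = j then c * of_real t else 0)" for i
    by (cases "i = j") (auto intro!: continuous_intros)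
  then have "continuous_on UNIV (\<lambda>t :: real. z + axis j (c * of_real t))"
    unfolding axis_def by (intro continuous_on_add continuous_on_const continuous_on_vec_lambda)
  then have "open ?S"
    using D(1) open_vimage by blast
  from has_vector_derivative_transform_within_open[OF der this] eq D(2)
  show ?thesis by (simp add: axis_eq_0_iff[THEN iffD2])
qed

lemma wirtinger_eqI:
  assumes "\<And>c. ((\<lambda>t. F (z + axis j (c * of_real t))) has_vector_derivative d c) (at 0)"
  shows "wirtinger j F z = (d 1 - \<i> * d \<i>) / 2" "wirtinger_cnj j F z = (d 1 + \<i> * d \<i>) / 2"
  using assms[of 1, THEN vector_derivative_at] assms[of \<i>, THEN vector_derivative_at]
  by (simp_all add: wirtinger_def wirtinger_cnj_def)

text \<open>The derivatives in the directions 1 and \<i> are 2 g' Re z_j and 2 g' Im z_j, which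
  combine to g' z_j.\<close>

lemma wirtinger_cnj_radial:
  assumes D: "open D" "z \<in> D" and eq: "\<And>x. x \<in> D \<Longrightarrow> F x = complex_of_real (g ((norm x)\<^sup>2))"
    and g: "(g has_real_derivative g') (at ((norm z)\<^sup>2))"
  shows "wirtinger_cnj j F z = of_real g' * z $ j"
proof -
  have "((\<lambda>t. F (z + axis j (c * of_real t))) has_vector_derivative of_real (g' * (2 * (z $ j \<bullet> c)))) (at 0)" for c
    by (rule has_vector_derivative_along_axis_cong[OF D eq has_vector_derivative_norm_square_along_axis[OF g]])
  from wirtinger_eqI(2)[OF this] show ?thesis
    by (simp add: inner_complex_def complex_eq_iff)
qed

text \<open>Product rule for a function of the shape produced by
  \<open>wirtinger_cnj_radial\<close>: the radial factor contributes g' times the conjugate of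
  \<open>z $ \<nu>\<close>, the component a Kronecker delta.\<close>

lemma wirtinger_radial_times_component:
  assumes D: "open D" "z \<in> D"
    and eq: "\<And>x. x \<in> D \<Longrightarrow> F x = complex_of_real (g ((norm x)\<^sup>2)) * x $ \<mu>"
    and g: "(g has_real_derivative g') (at ((norm z)\<^sup>2))"
  shows "wirtinger \<nu> F z = of_real g' * cnj (z $ \<nu>) * z $ \<mu> + (if \<nu> = \<mu> then of_real (g ((norm z)\<^sup>2)) else 0)"
proof -
  let ?d = "\<lambda>c. of_real (g ((norm z)\<^sup>2)) * (if \<nu> = \<mu> then c else 0) + of_real (g' * (2 * (z $ \<nu> \<bullet> c))) * z $ \<mu>"
  have "((\<lambda>t. F (z + axis \<nu> (c * of_real t))) has_vector_derivative ?d c) (at 0)" for c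
  proof (rule has_vector_derivative_along_axis_cong[OF D eq])
    have "((\<lambda>t :: real. c * complex_of_real t) has_vector_derivative c) (at 0)"
      using has_vector_derivative_mult_right[OF has_vector_derivative_of_real[OF DERIV_ident], where a=c] by simp
    then have "((\<lambda>t :: real. (z + axis \<nu> (c * of_real t)) $ \<mu>) has_vector_derivative (if \<nu> = \<mu> then c else 0)) (at 0)"
      by (cases "\<nu> = \<mu>") (auto simp: axis_def intro!: derivative_eq_intros)
    from has_vector_derivative_mult[OF has_vector_derivative_norm_square_along_axis[OF g, of \<nu> c] this]
    show "((\<lambda>t. complex_of_real (g ((norm (z + axis \<nu> (c * of_real t)))\<^sup>2)) * (z + axis \<nu> (c * of_real t)) $ \<mu>)
      has_vector_derivative ?d c) (at 0)"
      by (simp add: axis_eq_0_iff[THEN iffD2])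
  qed
  from wirtinger_eqI(1)[OF this] show ?thesis
    by (cases "\<nu> = \<mu>") (simp_all add: inner_complex_def complex_eq_iff algebra_simps)
qed

text \<open>The complex Hessian is \<open>g1\<close> times the identity plus \<open>g2\<close> times
  a rank-one matrix built from \<open>p\<close>. The derivative of \<open>g\<close> is required
  throughout \<open>D\<close> because it is differentiated once more at \<open>p\<close>.\<close>

lemma bergman_metric_radial:
  fixes D :: "(complex ^ 'n) set" and g g1 :: "real \<Rightarrow> real"
  assumes D: "open D" "p \<in> D"
    and eq: "\<And>z. z \<in> D \<Longrightarrow> ln (Re (bergman_kernel D z z)) = g ((norm z)\<^sup>2)"
    and g1: "\<And>z. z \<in> D \<Longrightarrow> (g has_real_derivative g1 ((norm z)\<^sup>2)) (at ((norm z)\<^sup>2))"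
    and g2: "(g1 has_real_derivative g2) (at ((norm p)\<^sup>2))"
  shows "bergman_metric D p \<xi> = sqrt (g1 ((norm p)\<^sup>2) * (norm \<xi>)\<^sup>2
    + g2 * (norm (\<Sum>\<nu>\<in>UNIV. cnj (p $ \<nu>) * \<xi> $ \<nu>))\<^sup>2)"
proof -
  let ?L = "\<lambda>z. complex_of_real (ln (Re (bergman_kernel D z z)))"
  let ?g = "complex_of_real (g1 ((norm p)\<^sup>2))"
  have c: "wirtinger_cnj \<mu> ?L z = of_real (g1 ((norm z)\<^sup>2)) * z $ \<mu>" if "z \<in> D" for z \<mu>
    by (rule wirtinger_cnj_radial[OF D(1) that _ g1[OF that]]) (simp add: eq)
  have w: "wirtinger \<nu> (wirtinger_cnj \<mu> ?L) p
    = of_real g2 * cnj (p $ \<nu>) * p $ \<mu> + (if \<nu> = \<mu> then ?g else 0)" for \<nu> \<mu>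
    by (rule wirtinger_radial_times_component[OF D c g2])
  have "(\<Sum>\<nu>\<in>UNIV. \<Sum>\<mu>\<in>UNIV. wirtinger \<nu> (wirtinger_cnj \<mu> ?L) p * \<xi> $ \<nu> * cnj (\<xi> $ \<mu>))
    = (\<Sum>\<nu>\<in>UNIV. \<Sum>\<mu>\<in>UNIV. of_real g2 * ((cnj (p $ \<nu>) * \<xi> $ \<nu>) * cnj (cnj (p $ \<mu>) * \<xi> $ \<mu>)))
      + (\<Sum>\<nu>\<in>UNIV. \<Sum>\<mu>\<in>UNIV. if \<nu> = \<mu> then ?g * (\<xi> $ \<nu> * cnj (\<xi> $ \<mu>)) else 0)"
    unfolding w sum.distrib[symmetric]
    by (intro sum.cong refl) (simp add: algebra_simps)
  also have "(\<Sum>\<nu>\<in>UNIV. \<Sum>\<mu>\<in>UNIV. of_real g2 * ((cnj (p $ \<nu>) * \<xi> $ \<nu>) * cnj (cnj (p $ \<mu>) * \<xi> $ \<mu>)))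
     = of_real g2 * ((\<Sum>\<nu>\<in>UNIV. cnj (p $ \<nu>) * \<xi> $ \<nu>) * cnj (\<Sum>\<nu>\<in>UNIV. cnj (p $ \<nu>) * \<xi> $ \<nu>))"
    by (simp only: cnj_sum sum_product) (simp only: sum_distrib_left)
  also have "\<dots> = of_real (g2 * (norm (\<Sum>\<nu>\<in>UNIV. cnj (p $ \<nu>) * \<xi> $ \<nu>))\<^sup>2)"
    unfolding of_real_mult complex_norm_square ..
  also have "(\<Sum>\<nu>\<in>UNIV. \<Sum>\<mu>\<in>UNIV. if \<nu> = \<mu> then ?g * (\<xi> $ \<nu> * cnj (\<xi> $ \<mu>)) else 0)
     = of_real (g1 ((norm p)\<^sup>2) * (norm \<xi>)\<^sup>2)"
  proof -
    have "(norm \<xi>)\<^sup>2 = (\<Sum>\<nu>\<in>UNIV. (norm (\<xi> $ \<nu>))\<^sup>2)"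
      by (simp add: norm_vec_def L2_set_def sum_nonneg)
    then show ?thesis
      by (simp only: of_real_mult of_real_sum complex_norm_square sum_distrib_left) simp
  qed
  finally show ?thesis
    unfolding bergman_metric_def by (simp add: add.commute)
qed

section \<open>Comparison of the shell with the ball\<close>

text \<open>Termwise derivative of the series of 1 / (1 - x)^2. Divided by pi^2, this is the kernel
  of the ball on the diagonal.\<close>

lemma quadratic_power_sums:
  fixes t :: real
  assumes "norm t < 1"
  shows "(\<lambda>k. real (k + 1) * real (k + 2) * t ^ k) sums (2 / (1 - t) ^ 3)"
proof -
  have g: "(\<lambda>n. real (n + 1) * x ^ n) sums (1 / (1 - x)\<^sup>2)" if "norm x < 1" for x :: real
    using geometric_deriv_sums[OF that] by simp
  have "((\<lambda>x. \<Sum>n. real (n + 1) * x ^ n) has_real_derivative (\<Sum>n. diffs (\<lambda>n. real (n + 1)) n * t ^ n)) (at t)"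
    by (rule termdiffs_strong'[where K=1]) (use g assms sums_summable in auto)
  moreover have "((\<lambda>x. \<Sum>n. real (n + 1) * x ^ n) has_real_derivative 2 / (1 - t) ^ 3) (at t)"
  proof (rule has_field_derivative_transform_within_open)
    show "((\<lambda>x. 1 / (1 - x)\<^sup>2) has_real_derivative 2 / (1 - t) ^ 3) (at t)"
      using assms by (auto intro!: derivative_eq_intros simp: divide_simps eval_nat_numeral)
    show "1 / (1 - x)\<^sup>2 = (\<Sum>n. real (n + 1) * x ^ n)" if "x \<in> ball 0 1" for x
      using g[of x] that by (intro sums_unique) auto
  qed (use assms in auto)
  ultimately have "(\<Sum>n. diffs (\<lambda>n. real (n + 1)) n * t ^ n) = 2 / (1 - t) ^ 3"
    by (rule DERIV_unique)
  moreover have "diffs (\<lambda>n. real (n + 1)) = (\<lambda>n. real (n + 1) * real (n + 2))"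
    by (auto simp: diffs_def)
  ultimately have "(\<Sum>n. real (n + 1) * real (n + 2) * t ^ n) = 2 / (1 - t) ^ 3"
    by (simp only:)
  with summable_sums[OF summable_quadratic_power[OF assms]] show ?thesis
    by (simp only:)
qed

text \<open>
  Up to the factor \<open>1 / pi\<^sup>2\<close>, the excess of the shell coefficients over those of the ball for \<open>q = r\<^sup>2\<close>,
  because \<open>1 / (1 - x) = 1 + x / (1 - x)\<close>.
\<close>

definition excess_coeff :: "real \<Rightarrow> nat \<Rightarrow> real"
  where "excess_coeff q k = real (k + 1) * real (k + 2) * (q ^ (k + 2) / (1 - q ^ (k + 2)))"

definition excess :: "real \<Rightarrow> real \<Rightarrow> real"
  where "excess q t = (\<Sum>k. excess_coeff q k * t ^ k)"

section \<open>Bounds for the excess series and its derivatives\<close>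

lemma one_minus_power_pos:
  assumes "0 < q" "q < (1 :: real)"
  shows "0 < 1 - q ^ (k + 2)"
  using power_Suc_less_one[OF assms, of "k + 1"] by simp

lemma excess_coeff_nonneg:
  assumes "0 < q" "q < 1"
  shows "0 \<le> excess_coeff q k"
  unfolding excess_coeff_def using assms one_minus_power_pos[OF assms, of k]
  by (intro mult_nonneg_nonneg divide_nonneg_pos) auto

text \<open>Among the denominators \<open>1 - q ^ (k + 2)\<close> the one at k = 0 is smallest.
  Besides it, a factor \<open>q ^ k\<close> is left to drive convergence.\<close>

lemma excess_coeff_le:
  assumes "0 < q" "q < 1"
  shows "excess_coeff q k \<le> real (k + 1) * real (k + 2) * (q\<^sup>2 / (1 - q\<^sup>2)) * q ^ k"
proof -
  have "q ^ (k + 2) \<le> q ^ 2" using assms by (intro power_decreasing) auto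
  moreover have "0 < 1 - q\<^sup>2"
    using one_minus_power_pos[OF assms, of 0] by (simp add: power2_eq_square)
  ultimately have "q ^ (k + 2) / (1 - q ^ (k + 2)) \<le> q ^ (k + 2) / (1 - q\<^sup>2)"
    using assms by (intro divide_left_mono mult_pos_pos one_minus_power_pos) auto
  also have "\<dots> = q\<^sup>2 / (1 - q\<^sup>2) * q ^ k" by (simp add: power_add mult_ac power2_eq_square)
  finally have "q ^ (k + 2) / (1 - q ^ (k + 2)) \<le> q\<^sup>2 / (1 - q\<^sup>2) * q ^ k" .
  from mult_left_mono[OF this, of "real (k + 1) * real (k + 2)"] show ?thesis
    by (simp add: excess_coeff_def mult_ac)
qed

lemma suminf_le_geometric:
  fixes f :: "nat \<Rightarrow> real"
  assumes "\<And>k. f k \<le> C * x ^ k" "summable f" "0 \<le> x" "x < 1"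
  shows "suminf f \<le> C / (1 - x)"
proof -
  have "suminf f \<le> (\<Sum>k. C * x ^ k)"
    using assms by (intro suminf_le summable_mult summable_geometric) auto
  also have "\<dots> = C / (1 - x)"
    using assms by (simp add: suminf_mult summable_geometric suminf_geometric)
  finally show ?thesis .
qed

text \<open>Consecutive left sides have quotient (k + 4) / (k + 1) <= 4. Such products occur in the
  coefficients of \<open>excess'\<close>, which this bound makes comparable to a geometric
  series.\<close>

lemma rising3_le: "real (k + 1) * real (k + 2) * real (k + 3) \<le> 6 * 4 ^ k"
proof (induction k)
  case (Suc k)
  have "real (k + 4) \<le> 4 * real (k + 1)" by simp
  then have "real (k + 2) * real (k + 3) * real (k + 4) \<le> real (k + 2) * real (k + 3) * (4 * real (k + 1))"
    by (intro mult_left_mono) auto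
  also have "\<dots> = 4 * (real (k + 1) * real (k + 2) * real (k + 3))" by (simp only: mult_ac)
  also have "\<dots> \<le> 4 * (6 * 4 ^ k)" using Suc by (intro mult_left_mono) auto
  finally show ?case by (simp add: add.commute)
qed simp

text \<open>As before, with quotient (k + 5) / (k + 1) <= 5, for the second derivative.\<close>

lemma rising4_le: "real (k + 1) * real (k + 2) * real (k + 3) * real (k + 4) \<le> 24 * 5 ^ k"
proof (induction k)
  case (Suc k)
  have "real (k + 5) \<le> 5 * real (k + 1)" by simp
  then have "real (k + 2) * real (k + 3) * real (k + 4) * real (k + 5)
      \<le> real (k + 2) * real (k + 3) * real (k + 4) * (5 * real (k + 1))"
    by (intro mult_left_mono) auto
  also have "\<dots> = 5 * (real (k + 1) * real (k + 2) * real (k + 3) * real (k + 4))" by (simp only: mult_ac)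
  also have "\<dots> \<le> 5 * (24 * 5 ^ k)" using Suc by (intro mult_left_mono) auto
  finally show ?case by (simp add: add.commute)
qed simp

text \<open>\<open>q\<close> stands for r^2 with \<open>r \<le> 1 / 10\<close>. The bound
  \<open>t \<le> 1 / 25\<close> imposed further on corresponds to points of norm at most
  1/5.\<close>

locale small_excess =
  fixes q :: real
  assumes q: "0 < q" "q \<le> 1 / 100"
begin

text \<open>Half the constant term of \<open>excess q\<close>; the series and its derivatives are
  measured in this unit.\<close>

definition "c0 = q\<^sup>2 / (1 - q\<^sup>2)"

lemma q1: "q < 1" using q by simp

lemma c0_pos: "0 < c0"
  using q one_minus_power_pos[of q 0] by (simp add: c0_def power2_eq_square)

lemma summable_excess: "norm t < 1 \<Longrightarrow> summable (\<lambda>k. excess_coeff q k * t ^ k)"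
proof (rule summable_comparison_test'[OF summable_mult[OF summable_quadratic_power, of _ c0]])
  fix k assume t: "norm t < 1"
  have "excess_coeff q k \<le> real (k + 1) * real (k + 2) * c0 * q ^ k"
    using excess_coeff_le[OF q(1) q1, of k] by (simp add: c0_def)
  also have "\<dots> \<le> real (k + 1) * real (k + 2) * c0 * 1"
    using q c0_pos by (intro mult_left_mono power_le_one mult_nonneg_nonneg) auto
  finally have "excess_coeff q k * norm t ^ k \<le> real (k + 1) * real (k + 2) * c0 * 1 * norm t ^ k"
    by (rule mult_right_mono) simp
  then show "norm (excess_coeff q k * t ^ k) \<le> c0 * (real (k + 1) * real (k + 2) * norm t ^ k)"
    using excess_coeff_nonneg[OF q(1) q1, of k] by (simp add: abs_mult power_abs mult_ac)
qed simp_all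

definition "excess' t = (\<Sum>k. diffs (excess_coeff q) k * t ^ k)"
definition "excess'' t = (\<Sum>k. diffs (diffs (excess_coeff q)) k * t ^ k)"

lemma summable_excess': "norm t < 1 \<Longrightarrow> summable (\<lambda>k. diffs (excess_coeff q) k * t ^ k)"
  by (rule termdiff_converges[OF _ summable_excess])

lemma summable_excess'': "norm t < 1 \<Longrightarrow> summable (\<lambda>k. diffs (diffs (excess_coeff q)) k * t ^ k)"
  by (rule termdiff_converges[OF _ summable_excess'])

lemma has_real_derivative_excess: "norm t < 1 \<Longrightarrow> (excess q has_real_derivative excess' t) (at t)"
  unfolding excess_def excess'_def
  by (rule termdiffs_strong'[where K=1]) (use summable_excess in auto)

lemma has_real_derivative_excess': "norm t < 1 \<Longrightarrow> (excess' has_real_derivative excess'' t) (at t)"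
  unfolding excess'_def excess''_def
  by (rule termdiffs_strong'[where K=1]) (use summable_excess' in auto)

context
  fixes t :: real
  assumes t: "0 \<le> t" "t \<le> 1 / 25"
begin

lemma norm_t: "norm t < 1" using t by simp

text \<open>All terms are nonnegative, and the constant one alone is \<open>2 * c0\<close>.\<close>

lemma excess_ge: "2 * c0 \<le> excess q t"
proof -
  have "(\<Sum>k\<in>{0}. excess_coeff q k * t ^ k) \<le> excess q t"
    unfolding excess_def using t excess_coeff_nonneg[OF q(1) q1]
    by (intro sum_le_suminf summable_excess norm_t) auto
  then show ?thesis by (simp add: excess_coeff_def c0_def power2_eq_square)
qed

lemma excess'_nonneg: "0 \<le> excess' t"
  unfolding excess'_def using t excess_coeff_nonneg[OF q(1) q1]
  by (intro suminf_nonneg summable_excess' norm_t) (auto simp: diffs_def)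

lemma excess''_nonneg: "0 \<le> excess'' t"
  unfolding excess''_def using t excess_coeff_nonneg[OF q(1) q1]
  by (intro suminf_nonneg summable_excess'' norm_t) (auto simp: diffs_def)

lemma qt: "0 \<le> q * t" "q * t \<le> 1 / 2500"
  using mult_mono[of q "1 / 100" t "1 / 25"] q t by auto

text \<open>Differentiation drops the constant term, so every remaining term carries an extra factor
  \<open>q\<close> besides \<open>c0\<close>; the polynomial factor is absorbed into the ratio
  \<open>4 * (q * t)\<close> of a geometric series.\<close>

lemma excess'_le: "excess' t \<le> c0 / 10"
proof -
  have "diffs (excess_coeff q) k * t ^ k \<le> (c0 * q * 6) * (4 * (q * t)) ^ k" for k
  proof -
    have idx: "k + 1 + 1 = k + 2" "k + 1 + 2 = k + 3" by simp_all
    have e: "excess_coeff q (k + 1) \<le> real (k + 2) * real (k + 3) * c0 * q ^ (k + 1)"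
      using excess_coeff_le[OF q(1) q1, of "k + 1"] unfolding c0_def idx .
    have "diffs (excess_coeff q) k * t ^ k = real (k + 1) * excess_coeff q (k + 1) * t ^ k"
      by (simp add: diffs_def)
    also have "\<dots> \<le> real (k + 1) * (real (k + 2) * real (k + 3) * c0 * q ^ (k + 1)) * t ^ k"
      using t by (intro mult_right_mono mult_left_mono e) auto
    also have "\<dots> = real (k + 1) * real (k + 2) * real (k + 3) * (c0 * q * (q * t) ^ k)"
      by (simp add: power_mult_distrib mult_ac)
    also have "\<dots> \<le> 6 * 4 ^ k * (c0 * q * (q * t) ^ k)"
      using q qt c0_pos by (intro mult_right_mono rising3_le) auto
    finally show ?thesis by (simp add: power_mult_distrib mult_ac)
  qed
  then have "excess' t \<le> c0 * q * 6 / (1 - 4 * (q * t))"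
    unfolding excess'_def using qt by (intro suminf_le_geometric summable_excess' norm_t) auto
  \<comment> \<open>As \<open>q * t \<le> 1 / 2500\<close>, the denominator is at least 6 / 10, a
    value chosen to leave \<open>10 * c0 * q\<close>.\<close>
  also have "\<dots> \<le> c0 * q * 6 / (6 / 10)"
    using q qt c0_pos by (intro divide_left_mono) auto
  also have "\<dots> \<le> c0 / 10"
    using mult_left_mono[OF q(2), of c0] c0_pos by simp
  finally show ?thesis .
qed

lemma excess''_le: "excess'' t \<le> c0"
proof -
  have "diffs (diffs (excess_coeff q)) k * t ^ k \<le> (c0 * q\<^sup>2 * 24) * (5 * (q * t)) ^ k" for k
  proof -
    have idx: "k + 2 + 1 = k + 3" "k + 2 + 2 = k + 4" by simp_all
    have e: "excess_coeff q (k + 2) \<le> real (k + 3) * real (k + 4) * c0 * q ^ (k + 2)"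
      using excess_coeff_le[OF q(1) q1, of "k + 2"] unfolding c0_def idx .
    have "diffs (diffs (excess_coeff q)) k * t ^ k
        = real (k + 1) * (real (k + 2) * excess_coeff q (k + 2)) * t ^ k"
      by (simp add: diffs_def)
    also have "\<dots> \<le> real (k + 1) * (real (k + 2) * (real (k + 3) * real (k + 4) * c0 * q ^ (k + 2))) * t ^ k"
      using t by (intro mult_right_mono mult_left_mono e) auto
    also have "\<dots> = real (k + 1) * real (k + 2) * real (k + 3) * real (k + 4) * (c0 * q\<^sup>2 * (q * t) ^ k)"
      by (simp add: power_mult_distrib power_add power2_eq_square mult_ac)
    also have "\<dots> \<le> 24 * 5 ^ k * (c0 * q\<^sup>2 * (q * t) ^ k)"
      using q qt c0_pos by (intro mult_right_mono rising4_le) auto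
    finally show ?thesis by (simp add: power_mult_distrib mult_ac)
  qed
  then have "excess'' t \<le> c0 * q\<^sup>2 * 24 / (1 - 5 * (q * t))"
    unfolding excess''_def using qt by (intro suminf_le_geometric summable_excess'' norm_t) auto
  \<comment> \<open>Likewise the denominator is at least 24 / 100, which leaves 100 c0 q^2.\<close>
  also have "\<dots> \<le> c0 * q\<^sup>2 * 24 / (24 / 100)"
    using q qt c0_pos by (intro divide_left_mono) auto
  also have "\<dots> \<le> c0 * 1"
    using power_mono[of q "1 / 100" 2] q c0_pos by (auto simp: power2_eq_square)
  finally show ?thesis by simp
qed

end

text \<open>The kernel of the shell on the diagonal is that of the ball times \<open>1 + ratio |z|\<^sup>2\<close>.\<close>

definition "ratio t = (1 - t) ^ 3 / 2 * excess q t"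
definition "ratio' t = ((1 - t) ^ 3 * excess' t - 3 * (1 - t)\<^sup>2 * excess q t) / 2"
definition "ratio'' t = ((1 - t) ^ 3 * excess'' t - 6 * (1 - t)\<^sup>2 * excess' t + 6 * (1 - t) * excess q t) / 2"

lemma has_real_derivative_ratio: "norm t < 1 \<Longrightarrow> (ratio has_real_derivative ratio' t) (at t)"
  unfolding ratio_def[abs_def] ratio'_def
  by (auto intro!: derivative_eq_intros has_real_derivative_excess simp: field_simps)

lemma has_real_derivative_ratio': "norm t < 1 \<Longrightarrow> (ratio' has_real_derivative ratio'' t) (at t)"
  unfolding ratio'_def[abs_def] ratio''_def
  by (auto intro!: derivative_eq_intros has_real_derivative_excess has_real_derivative_excess'
      simp: field_simps power2_eq_square)

text \<open>Keeps \<open>1 + ratio t\<close> positive, as its logarithm and the quotients by it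
  require.\<close>

lemma ratio_nonneg: "0 \<le> t \<Longrightarrow> t < 1 \<Longrightarrow> 0 \<le> ratio t"
  unfolding ratio_def excess_def using excess_coeff_nonneg[OF q(1) q1]
  by (intro mult_nonneg_nonneg suminf_nonneg summable_excess) auto

text \<open>With (1 - t)^2 / 2 split off and h = \<open>excess q\<close>, the sign is that of (1 -
  t) h' - 3 h, where h' <= c0 / 10 and 3 h >= 6 c0.\<close>

lemma ratio'_neg:
  assumes t: "0 \<le> t" "t \<le> 1 / 25"
  shows "ratio' t < 0"
proof -
  have "(1 - t) * excess' t \<le> 1 * excess' t"
    using t excess'_nonneg[OF t] by (intro mult_right_mono) auto
  then have "(1 - t) * excess' t - 3 * excess q t < 0"
    using excess'_le[OF t] excess_ge[OF t] c0_pos by linarith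
  moreover have "0 < (1 - t)\<^sup>2 / 2" using t by simp
  ultimately have "(1 - t)\<^sup>2 / 2 * ((1 - t) * excess' t - 3 * excess q t) < 0"
    by (rule mult_pos_neg[rotated])
  also have "(1 - t)\<^sup>2 / 2 * ((1 - t) * excess' t - 3 * excess q t) = ratio' t"
    by (simp add: ratio'_def field_simps power2_eq_square power3_eq_cube)
  finally show ?thesis .
qed

text \<open>With (1 - t) / 2 split off, the positive terms in h' and h'' amount to at most c0 / 10 +
  c0 / 25, whereas the negative term (3 - 9 t) h is at least 2 h >= 4 c0 in size.\<close>

lemma ratio'_plus_ratio''_neg:
  assumes t: "0 \<le> t" "t \<le> 1 / 25"
  shows "ratio' t + t * ratio'' t < 0"
proof -
  have "(1 - t)\<^sup>2 \<le> 1" using t by (intro power_le_one) auto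
  then have 1: "(1 - t)\<^sup>2 * excess' t \<le> excess' t" "(1 - t)\<^sup>2 * (t * excess'' t) \<le> t * excess'' t"
    using t excess'_nonneg[OF t] excess''_nonneg[OF t] mult_right_mono[of "(1 - t)\<^sup>2" 1] by auto
  have 2: "t * excess'' t \<le> 1 / 25 * c0"
    using t excess''_le[OF t] excess''_nonneg[OF t] by (intro mult_mono) auto
  have 3: "0 \<le> 6 * t * (1 - t) * excess' t"
    using t excess'_nonneg[OF t] by auto
  have 4: "2 * excess q t \<le> (3 - 9 * t) * excess q t"
    using t excess_ge[OF t] c0_pos by (intro mult_right_mono) auto
  have "(1 - t)\<^sup>2 * excess' t + (1 - t)\<^sup>2 * (t * excess'' t) - 6 * t * (1 - t) * excess' t
      - (3 - 9 * t) * excess q t < 0"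
    using 1 2 3 4 excess'_le[OF t] excess_ge[OF t] c0_pos by linarith
  moreover have "0 < (1 - t) / 2" using t by simp
  ultimately have "(1 - t) / 2 * ((1 - t)\<^sup>2 * excess' t + (1 - t)\<^sup>2 * (t * excess'' t) - 6 * t * (1 - t) * excess' t
      - (3 - 9 * t) * excess q t) < 0"
    by (rule mult_pos_neg[rotated])
  also have "(1 - t) / 2 * ((1 - t)\<^sup>2 * excess' t + (1 - t)\<^sup>2 * (t * excess'' t) - 6 * t * (1 - t) * excess' t
      - (3 - 9 * t) * excess q t) = ratio' t + t * ratio'' t"
    by (simp add: ratio'_def ratio''_def field_simps power2_eq_square power3_eq_cube)
  finally show ?thesis .
qed

end

section \<open>The kernels on the diagonal and the comparison of the metrics\<close>

lemma Re_shell_series_of_real: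
  assumes "r < 1" "0 \<le> t" "t < 1"
  shows "Re (shell_series r (of_real t)) = (\<Sum>k. shell_coeff r k * t ^ k)"
proof -
  have "(\<lambda>k. complex_of_real (shell_coeff r k * t ^ k)) sums shell_series r (of_real t)"
    using shell_series_sums[of r "of_real t"] assms by simp
  from sums_Re[OF this] show ?thesis by (simp add: sums_unique)
qed

text \<open>For \<open>r = -1\<close> the number \<open>max 0 r\<close> is 0, so the denominators of
  \<open>shell_coeff\<close> reduce to pi^2 and the series has a closed form.\<close>

lemma Re_ball_series:
  assumes "0 \<le> t" "t < 1"
  shows "Re (shell_series (- 1) (of_real t)) = 2 / (pi\<^sup>2 * (1 - t) ^ 3)"
proof -
  have "(\<lambda>k. 1 / pi\<^sup>2 * (real (k + 1) * real (k + 2) * t ^ k)) sums (1 / pi\<^sup>2 * (2 / (1 - t) ^ 3))"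
    using assms by (intro sums_mult quadratic_power_sums) auto
  then have "(\<lambda>k. shell_coeff (- 1) k * t ^ k) sums (2 / (pi\<^sup>2 * (1 - t) ^ 3))"
    by (simp add: shell_coeff_def power_0_left mult_ac add_ac)
  from sums_unique[OF this] show ?thesis
    using Re_shell_series_of_real[of "-1" t] assms by simp
qed

lemma Re_shell_series:
  assumes r: "0 < r" "r \<le> 1 / 10" and t: "0 \<le> t" "t < 1"
  shows "Re (shell_series r (of_real t)) = 2 / (pi\<^sup>2 * (1 - t) ^ 3) * (1 + small_excess.ratio (r\<^sup>2) t)"
proof -
  interpret small_excess "r\<^sup>2"
    using r power_mono[of r "1 / 10" 2] by unfold_locales (auto simp: power2_eq_square)
  have coeff: "shell_coeff r k = 1 / pi\<^sup>2 * (real (k + 1) * real (k + 2) + excess_coeff (r\<^sup>2) k)" for k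
  proof -
    have "2 * k + 4 = 2 * (k + 2)" by simp
    then have "r ^ (2 * k + 4) = (r\<^sup>2) ^ (k + 2)" by (simp only: power_mult)
    then show ?thesis
      using r one_minus_power_pos[OF q(1) q1, of k]
      by (simp add: shell_coeff_def excess_coeff_def max_def divide_simps) (simp add: algebra_simps)
  qed
  have "(\<lambda>k. 1 / pi\<^sup>2 * (real (k + 1) * real (k + 2) * t ^ k + excess_coeff (r\<^sup>2) k * t ^ k))
      sums (1 / pi\<^sup>2 * (2 / (1 - t) ^ 3 + excess (r\<^sup>2) t))"
    unfolding excess_def using t
    by (intro sums_mult sums_add quadratic_power_sums summable_sums summable_excess) auto
  then have "(\<lambda>k. shell_coeff r k * t ^ k) sums (1 / pi\<^sup>2 * (2 / (1 - t) ^ 3 + excess (r\<^sup>2) t))"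
    unfolding coeff by (simp add: algebra_simps)
  from sums_unique[OF this]
  have "Re (shell_series r (of_real t)) = 1 / pi\<^sup>2 * (2 / (1 - t) ^ 3 + excess (r\<^sup>2) t)"
    using Re_shell_series_of_real[of r t] r t by simp
  also have "\<dots> = 2 / (pi\<^sup>2 * (1 - t) ^ 3) * (1 + ratio t)"
    using t by (simp add: ratio_def field_simps)
  finally show ?thesis .
qed

definition ball_potential :: "real \<Rightarrow> real"
  where "ball_potential t = ln (2 / (pi\<^sup>2 * (1 - t) ^ 3))"

lemma has_real_derivative_ball_potential:
  assumes "t < 1"
  shows "(ball_potential has_real_derivative 3 / (1 - t)) (at t)"
proof -
  have "((\<lambda>t. ln (2 / pi\<^sup>2) - 3 * ln (1 - t)) has_real_derivative 3 / (1 - t)) (at t)"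
    using assms by (auto intro!: derivative_eq_intros)
  then show ?thesis
  proof (rule has_field_derivative_transform_within_open)
    show "ln (2 / pi\<^sup>2) - 3 * ln (1 - x) = ball_potential x" if "x \<in> {..<1}" for x
      using that by (simp add: ball_potential_def ln_div ln_mult ln_realpow)
  qed (use assms in auto)
qed

lemma norm_square_shell_lt_1: "z \<in> shell r \<Longrightarrow> (norm z)\<^sup>2 < 1"
  by (simp add: shell_def power_less_one_iff abs_square_less_1)

lemma bergman_kernel_shell_diagonal:
  assumes "r < 1" "z \<in> shell r"
  shows "Re (bergman_kernel (shell r) z z) = Re (shell_series r (of_real ((norm z)\<^sup>2)))"
  using assms by (simp add: bergman_kernel_shell shell_kernel_def hdot_self)

lemma bergman_metric_ball:
  assumes p: "p \<in> shell (- 1)"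
  shows "bergman_metric (shell (- 1)) p \<xi> = sqrt (3 / (1 - (norm p)\<^sup>2) * (norm \<xi>)\<^sup>2
    + 3 / (1 - (norm p)\<^sup>2)\<^sup>2 * (norm (\<Sum>\<nu>\<in>UNIV. cnj (p $ \<nu>) * \<xi> $ \<nu>))\<^sup>2)"
proof (rule bergman_metric_radial[OF open_shell p])
  show "ln (Re (bergman_kernel (shell (- 1)) z z)) = ball_potential ((norm z)\<^sup>2)" if "z \<in> shell (- 1)" for z
    using that norm_square_shell_lt_1[OF that]
    by (simp add: bergman_kernel_shell_diagonal Re_ball_series ball_potential_def del: of_real_power)
  show "(ball_potential has_real_derivative 3 / (1 - (norm z)\<^sup>2)) (at ((norm z)\<^sup>2))" if "z \<in> shell (- 1)" for z
    using norm_square_shell_lt_1[OF that] by (rule has_real_derivative_ball_potential)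
  show "((\<lambda>t. 3 / (1 - t)) has_real_derivative 3 / (1 - (norm p)\<^sup>2)\<^sup>2) (at ((norm p)\<^sup>2))"
    using norm_square_shell_lt_1[OF p] by (auto intro!: derivative_eq_intros simp: power2_eq_square)
qed

text \<open>The differentiated function is the derivative of the ball potential plus that of ln (1 +
  u); the result is the second derivative that \<open>bergman_metric_radial\<close> needs for the
  shell.\<close>

lemma log_derivative_quotient:
  fixes u u1 :: "real \<Rightarrow> real"
  assumes "(u has_real_derivative u1 t) (at t)" "(u1 has_real_derivative u2) (at t)"
    and "0 < 1 + u t" "t < 1"
  shows "((\<lambda>t. 3 / (1 - t) + u1 t / (1 + u t)) has_real_derivative
    3 / (1 - t)\<^sup>2 + (u2 / (1 + u t) - (u1 t / (1 + u t))\<^sup>2)) (at t)"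
  using assms(3,4)
  by (auto intro!: derivative_eq_intros assms(1,2) simp: power2_eq_square diff_divide_distrib)

text \<open>Under the square root the shell differs from the ball by \<open>\<delta> t\<close>
  |\<xi>|^2 + \<open>\<delta>' * s\<close>, where 0 <= s <= t |\<xi>|^2 by Cauchy-Schwarz. This is
  affine in \<open>s\<close>, so negativity at both ends suffices, and \<open>ratio'_neg\<close> and
  \<open>ratio'_plus_ratio''_neg\<close> supply it.\<close>

lemma bergman_metric_shell_less_ball:
  assumes r: "0 < r" "r < 1 / 10" and p: "p \<in> shell r" "(norm p)\<^sup>2 \<le> 1 / 25" and \<xi>: "\<xi> \<noteq> 0"
  shows "bergman_metric (shell r) p \<xi> < bergman_metric (shell (- 1)) p \<xi>"
proof -
  interpret small_excess "r\<^sup>2"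
    using r power_mono[of r "1 / 10" 2] by unfold_locales (auto simp: power2_eq_square)
  define t where "t = (norm p)\<^sup>2"
  have t: "0 \<le> t" "t \<le> 1 / 25" using p by (auto simp: t_def)
  define \<delta> where "\<delta> t = ratio' t / (1 + ratio t)" for t
  define \<delta>' where "\<delta>' = ratio'' t / (1 + ratio t) - (ratio' t / (1 + ratio t))\<^sup>2"
  define s where "s = (norm (\<Sum>\<nu>\<in>UNIV. cnj (p $ \<nu>) * \<xi> $ \<nu>))\<^sup>2"
  have pos: "0 < 1 + ratio x" if "0 \<le> x" "x < 1" for x
    using ratio_nonneg[OF that] by simp
  have shell: "bergman_metric (shell r) p \<xi> = sqrt ((3 / (1 - t) + \<delta> t) * (norm \<xi>)\<^sup>2
    + (3 / (1 - t)\<^sup>2 + \<delta>') * s)"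
    unfolding t_def s_def
  proof (rule bergman_metric_radial[OF open_shell p(1), where g="\<lambda>t. ball_potential t + ln (1 + ratio t)"
        and ?g1.0="\<lambda>t. 3 / (1 - t) + \<delta> t"])
    fix z assume z: "z \<in> shell r"
    note z1 = norm_square_shell_lt_1[OF z]
    have "Re (bergman_kernel (shell r) z z) = 2 / (pi\<^sup>2 * (1 - (norm z)\<^sup>2) ^ 3) * (1 + ratio ((norm z)\<^sup>2))"
      using z z1 r by (simp only: bergman_kernel_shell_diagonal) (intro Re_shell_series; simp)
    then show "ln (Re (bergman_kernel (shell r) z z)) = ball_potential ((norm z)\<^sup>2) + ln (1 + ratio ((norm z)\<^sup>2))"
      unfolding ball_potential_def using z1 pos[of "(norm z)\<^sup>2"] by (simp only:) (rule ln_mult_pos; simp)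
    show "((\<lambda>t. ball_potential t + ln (1 + ratio t)) has_real_derivative
        3 / (1 - (norm z)\<^sup>2) + \<delta> ((norm z)\<^sup>2)) (at ((norm z)\<^sup>2))"
      unfolding \<delta>_def using z1 pos[of "(norm z)\<^sup>2"]
      by (auto intro!: derivative_eq_intros has_real_derivative_ball_potential has_real_derivative_ratio)
  next
    have "((\<lambda>t. 3 / (1 - t) + \<delta> t) has_real_derivative 3 / (1 - t)\<^sup>2 + \<delta>') (at t)"
      unfolding \<delta>_def \<delta>'_def using t pos[of t]
      by (intro log_derivative_quotient has_real_derivative_ratio has_real_derivative_ratio') auto
    then show "((\<lambda>t. 3 / (1 - t) + \<delta> t) has_real_derivative 3 / (1 - (norm p)\<^sup>2)\<^sup>2 + \<delta>') (at ((norm p)\<^sup>2))"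
      by (simp add: t_def)
  qed
  have ball: "bergman_metric (shell (- 1)) p \<xi> = sqrt (3 / (1 - t) * (norm \<xi>)\<^sup>2 + 3 / (1 - t)\<^sup>2 * s)"
    unfolding t_def s_def by (rule bergman_metric_ball) (use p r in \<open>auto simp: shell_def\<close>)
  have s: "0 \<le> s" "s \<le> t * (norm \<xi>)\<^sup>2"
  proof -
    have "(\<Sum>\<nu>\<in>UNIV. cnj (p $ \<nu>) * \<xi> $ \<nu>) = hdot \<xi> p" by (simp add: sum_2 hdot_def mult.commute)
    then show "s \<le> t * (norm \<xi>)\<^sup>2"
      using power_mono[OF norm_hdot_le[of \<xi> p] norm_ge_zero, of 2]
      by (simp add: s_def t_def power_mult_distrib mult.commute)
  qed (simp add: s_def)
  have 1: "\<delta> t < 0"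
    unfolding \<delta>_def using ratio'_neg[OF t] pos[of t] t by (simp add: divide_neg_pos)
  \<comment> \<open>The square that arises from differentiating the quotient enters with a minus
    sign and so only helps.\<close>
  have "\<delta> t + t * \<delta>' = (ratio' t + t * ratio'' t) / (1 + ratio t) - t * (ratio' t / (1 + ratio t))\<^sup>2"
    by (simp add: \<delta>_def \<delta>'_def algebra_simps add_divide_distrib)
  also have "\<dots> < 0"
  proof -
    have "(ratio' t + t * ratio'' t) / (1 + ratio t) < 0"
      using ratio'_plus_ratio''_neg[OF t] pos[of t] t by (intro divide_neg_pos) auto
    moreover have "0 \<le> t * (ratio' t / (1 + ratio t))\<^sup>2" using t by simp
    ultimately show ?thesis by linarith
  qed
  finally have 2: "\<delta> t + t * \<delta>' < 0" .
  have "\<delta> t * (norm \<xi>)\<^sup>2 + \<delta>' * s < 0"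
  \<comment> \<open>The sign of \<open>\<delta>'\<close> tells at which end of the range of
    \<open>s\<close> the expression is largest.\<close>
  proof (cases "\<delta>' \<le> 0")
    case True
    then have "\<delta>' * s \<le> 0" using s by (simp add: mult_nonpos_nonneg)
    moreover have "\<delta> t * (norm \<xi>)\<^sup>2 < 0" using 1 \<xi> by (simp add: mult_neg_pos)
    ultimately show ?thesis by linarith
  next
    case False
    then have "\<delta>' * s \<le> \<delta>' * (t * (norm \<xi>)\<^sup>2)" using s by (intro mult_left_mono) auto
    then have "\<delta> t * (norm \<xi>)\<^sup>2 + \<delta>' * s \<le> (\<delta> t + t * \<delta>') * (norm \<xi>)\<^sup>2" by (simp add: algebra_simps)
    also have "\<dots> < 0" using 2 \<xi> by (simp add: mult_neg_pos)
    finally show ?thesis .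
  qed
  then show ?thesis
    unfolding shell ball by (intro real_sqrt_less_mono) (simp add: algebra_simps)
qed

theorem theorem3:
  "\<exists>r0::real. 0 < r0 \<and> r0 < 1 \<and>
    (\<forall>r. 0 < r \<and> r < r0 \<longrightarrow>
      (\<exists>\<epsilon>0>0. r + \<epsilon>0 < 1 \<and>
        (\<forall>\<epsilon>. 0 < \<epsilon> \<and> \<epsilon> < \<epsilon>0 \<longrightarrow>
          (\<forall>\<xi>::complex ^ 2. \<xi> \<noteq> 0 \<longrightarrow>
            bergman_metric (shell r) (vector [complex_of_real (r + \<epsilon>), 0]) \<xi>
              < bergman_metric {z. norm z < 1} (vector [complex_of_real (r + \<epsilon>), 0]) \<xi>))))"
\<comment> \<open>The witness 1/10 serves for both \<open>r0\<close> and \<open>\<epsilon>0\<close>: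
  the point then has norm \<open>r + \<epsilon> < 1 / 5\<close>, so its square stays within the
  range 1/25 of the estimates.\<close>
proof (intro exI[of _ "1 / 10"] conjI allI impI)
  fix r \<epsilon> :: real and \<xi> :: "complex ^ 2"
  assume r: "0 < r \<and> r < 1 / 10" and \<epsilon>: "0 < \<epsilon> \<and> \<epsilon> < 1 / 10" and \<xi>: "\<xi> \<noteq> 0"
  let ?p = "vector [complex_of_real (r + \<epsilon>), 0] :: complex ^ 2"
  have norm_p: "norm ?p = r + \<epsilon>"
    using r \<epsilon> by (simp add: norm_vec_def L2_set_def sum_2 flip: of_real_add)
  have "(r + \<epsilon>)\<^sup>2 \<le> (1 / 5)\<^sup>2"
    using r \<epsilon> by (intro power_mono) auto
  then have "bergman_metric (shell r) ?p \<xi> < bergman_metric (shell (- 1)) ?p \<xi>"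
    using r \<epsilon> \<xi> norm_p
    by (intro bergman_metric_shell_less_ball) (auto simp: shell_def power2_eq_square)
  also have "shell (- 1) = {z. norm z < 1}"
    by (auto simp: shell_def intro: less_le_trans[OF _ norm_ge_zero])
  finally show "bergman_metric (shell r) ?p \<xi> < bergman_metric {z. norm z < 1} ?p \<xi>" .
qed auto

end
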